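(* Let $K\subset\mathbb{R}$ be a compact uniformly perfect set with $\operatorname{cap}(K)>0$. Then there exists a constant $c=c(K)>0$ such that $$t_n(K)=O(n^c)\quad\text{as } n\to\infty.$$
   Context: $\operatorname{cap}(K)$ denotes logarithmic capacity; $\operatorname{diam}(S)=\sup_{z,\zeta\in S}|z-\zeta|$. For $n\in\mathbb{N}=\{1,2,\dots\}$, $T_n(z)=T_n(z,K)$ is the $n$-th Chebyshev polynomial of $K$, i.e. the unique monic polynomial of degree $n$ with complex coefficients minimizing the supremum norm $\|T_n\|_K=\sup_{z\in K}|T_n(z)|$ among all monic polynomials of degree $n$; and $t_n(K)=\|T_n\|_K/\operatorname{cap}(K)^n$. A compact set $K$ is uniformly perfect if there exists a constant $0<\gamma_K<1$ such that for every $z\in K$ and every $r$ with $0<r<\operatorname{diam}(K)$, $K\cap\{\zeta:\gamma_K r\le|\zeta-z|\le r\}\neq\emptyset$. *)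

theory Defs
  imports
    "HOL-Probability.Probability"
    "HOL-Computational_Algebra.Polynomial"
    "HOL-Library.Landau_Symbols"
begin

definition log_kernel :: "complex \<Rightarrow> complex \<Rightarrow> ereal" where
  "log_kernel z w = (if z = w then \<infinity> else ereal (ln (1 / dist z w)))"

text \<open>
  The energy is the double integral of the logarithmic kernel, taken as the integral of its positive
  part minus that of its negative part (\<open>e2ennreal\<close> truncates negative values to 0). For a measure
  carried by a bounded set the negative part is bounded, so the difference is never
  \<open>\<infinity> - \<infinity>\<close>.
\<close>

definition log_energy :: "complex measure \<Rightarrow> ereal" where
  "log_energy \<mu> =
     enn2ereal (\<integral>\<^sup>+ (z, w). e2ennreal (log_kernel z w) \<partial>(\<mu> \<Otimes>\<^sub>M \<mu>)) -
     enn2ereal (\<integral>\<^sup>+ (z, w). e2ennreal (- log_kernel z w) \<partial>(\<mu> \<Otimes>\<^sub>M \<mu>))"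

definition prob_measures_on :: "complex set \<Rightarrow> complex measure set" where
  "prob_measures_on K = {\<mu>. sets \<mu> = sets borel \<and> prob_space \<mu> \<and> emeasure \<mu> K = 1}"

definition robin_constant :: "complex set \<Rightarrow> ereal" where
  "robin_constant K = (INF \<mu>\<in>prob_measures_on K. log_energy \<mu>)"

text \<open>
  The logarithmic capacity \<open>exp (- V)\<close> of a compact set, where \<open>V\<close> is the minimal energy.
  Here \<open>V > - \<infinity>\<close>, so \<open>real_of_ereal\<close> is only applied to finite values.
\<close>

definition log_cap :: "complex set \<Rightarrow> real" where
  "log_cap K =
     (if robin_constant K = \<infinity> then 0 else exp (- real_of_ereal (robin_constant K)))"

definition sup_norm_on :: "complex set \<Rightarrow> complex poly \<Rightarrow> real" where
  "sup_norm_on K p = (SUP z\<in>K. cmod (poly p z))"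

definition is_chebyshev_poly :: "complex set \<Rightarrow> nat \<Rightarrow> complex poly \<Rightarrow> bool" where
  "is_chebyshev_poly K n p \<longleftrightarrow>
     is_arg_min (sup_norm_on K) (\<lambda>q. degree q = n \<and> lead_coeff q = 1) p"

text \<open>The minimizer exists and is unique whenever \<open>K\<close> is compact and infinite.\<close>

definition chebyshev_poly :: "complex set \<Rightarrow> nat \<Rightarrow> complex poly" where
  "chebyshev_poly K n = (THE p. is_chebyshev_poly K n p)"

definition widom_factor :: "complex set \<Rightarrow> nat \<Rightarrow> real" where
  "widom_factor K n = sup_norm_on K (chebyshev_poly K n) / log_cap K ^ n"

definition uniformly_perfect :: "complex set \<Rightarrow> bool" where
  "uniformly_perfect K \<longleftrightarrow>
     (\<exists>\<gamma>. 0 < \<gamma> \<and> \<gamma> < 1 \<and>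
       (\<forall>z\<in>K. \<forall>r. 0 < r \<and> r < diameter K \<longrightarrow>
          K \<inter> {\<zeta>. \<gamma> * r \<le> cmod (\<zeta> - z) \<and> cmod (\<zeta> - z) \<le> r} \<noteq> {}))"

end

theory Submission imports Defs begin

text \<open>
  Write \<open>\<tau> k\<close> for the norm of the \<open>k\<close>-th Chebyshev polynomial and \<open>\<alpha> k = ln (\<tau> k) - k * ln (log_cap K)\<close> for
  the logarithm of the Widom factor. A product of monic polynomials is monic, so \<open>\<alpha>\<close> is subadditive;
  adding \<open>\<alpha> n \<le> \<alpha> k + \<alpha> (n - k)\<close> over all \<open>k \<le> n\<close> bounds \<open>\<alpha> n\<close> by twice the average of
  \<open>\<alpha> 0, \<dots>, \<alpha> n\<close> (\<open>subadditive_le_twice_average\<close>). It is therefore enough to bound averages, and these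
  are controlled by a single discrete energy.

  Choose Leja points: \<open>z k\<close> maximizes \<open>\<Prod>j<k. dist x (z j)\<close> over \<open>x \<in> K\<close>. That maximum is the norm of
  a monic polynomial of degree \<open>k\<close>, hence at least \<open>\<tau> k\<close>, and so the sum of \<open>ln (\<tau> k)\<close> over \<open>1 \<le> k < N\<close> is at
  most the sum of \<open>ln (dist (z i) (z j))\<close> over the pairs among the first \<open>N\<close> points. To compare the
  latter with the capacity, replace each point \<open>z i\<close> by a probability measure on the part of \<open>K\<close>
  within a small distance \<open>R\<close> of \<open>z i\<close>, and average these measures. The average is a probability measure on
  \<open>K\<close>, so its energy is at least \<open>- ln (log_cap K)\<close>. The smearing changes the mutual energies little if
  \<open>R\<close> is small compared with the distances between the points, and each self-energy is
  \<open>ln (1 / R) + O(1)\<close>. If \<open>R\<close> can be taken to be a negative power of \<open>N\<close>, the self-energies contribute only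
  \<open>O(N * ln N)\<close>, which is \<open>O(ln N)\<close> after averaging, and the factor of \<open>ln N\<close> is the exponent \<open>c\<close>
  (\<open>ln_distances_le_capacity\<close>, \<open>sum_ln_chebyshev_norms_le\<close>).

  Uniform perfectness enters the estimates twice, through one construction. It lets a binary tree of points be
  grown in \<open>K\<close> from any point at any scale \<open>R\<close>, and the coin-tossing measure on the ends of this
  tree charges each ball of radius \<open>R * q ^ m\<close> with at most \<open>(1/2) ^ m\<close> (\<open>cantor_measure_exists\<close>). Such a measure
  has potential at most \<open>ln (1 / R) + O(1)\<close> everywhere, which gives the bound on the self-energies. It
  also gives the power separation of Leja points (\<open>leja_separation\<close>): the potential of
  \<open>z 0, \<dots>, z (k - 1)\<close> at \<open>z k\<close> cannot exceed its mean over the measure at \<open>z k\<close> of scale \<open>R\<close>. Written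
  with \<open>G R = (\<Sum>j<k. ln (1 + R / dist (z k) (z j)))\<close>, this says \<open>G R \<le> A * (G (2 * R) - G R)\<close> for a
  constant \<open>A\<close>, so \<open>G\<close> decays like a power of \<open>R\<close>, starting from a value of order \<open>k\<close>. Once \<open>G R\<close> is below
  \<open>ln 2\<close>, no earlier point lies within distance \<open>R\<close> of \<open>z k\<close>.
\<close>

section \<open>Existence and uniqueness of Chebyshev polynomials\<close>

lemma cmod_poly_le_sup_norm_on:
  assumes "compact K" "z \<in> K"
  shows "cmod (poly p z) \<le> sup_norm_on K p"
proof -
  have "compact ((\<lambda>z. cmod (poly p z)) ` K)"
    by (intro compact_continuous_image continuous_intros assms)
  then have "bdd_above ((\<lambda>z. cmod (poly p z)) ` K)"
    by (simp add: compact_imp_bounded bounded_imp_bdd_above)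
  with assms(2) show ?thesis
    unfolding sup_norm_on_def by (rule cSUP_upper)
qed

lemma sup_norm_on_le:
  assumes "K \<noteq> {}" "\<And>z. z \<in> K \<Longrightarrow> cmod (poly p z) \<le> M"
  shows "sup_norm_on K p \<le> M"
  unfolding sup_norm_on_def using assms by (rule cSUP_least)

lemma sup_norm_on_attained:
  assumes "compact K" "K \<noteq> {}"
  obtains z where "z \<in> K" "cmod (poly p z) = sup_norm_on K p"
proof -
  have "continuous_on K (\<lambda>z. cmod (poly p z))"
    by (intro continuous_intros)
  from continuous_attains_sup[OF assms this] obtain z
    where z: "z \<in> K" "\<And>y. y \<in> K \<Longrightarrow> cmod (poly p y) \<le> cmod (poly p z)"
    by blast
  have "sup_norm_on K p \<le> cmod (poly p z)"
    using assms(2) z(2) by (rule sup_norm_on_le)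
  with cmod_poly_le_sup_norm_on[OF assms(1) z(1)] z(1) that show ?thesis
    by (meson order_antisym)
qed

lemma sup_norm_on_nonneg:
  assumes "compact K" "K \<noteq> {}"
  shows "0 \<le> sup_norm_on K p"
  using sup_norm_on_attained[OF assms, of p] by (metis norm_ge_zero)

lemma sup_norm_on_pos:
  assumes "compact K" "infinite K" "p \<noteq> 0"
  shows "0 < sup_norm_on K p"
proof -
  have "\<not> K \<subseteq> {z. poly p z = 0}"
    using assms(2) poly_roots_finite[OF assms(3)] finite_subset by blast
  then obtain z where "z \<in> K" "poly p z \<noteq> 0"
    by blast
  then show ?thesis
    using cmod_poly_le_sup_norm_on[OF assms(1), of z p] by (meson less_le_trans zero_less_norm_iff)
qed

lemma sup_norm_on_mult_le:
  assumes "compact K" "K \<noteq> {}"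
  shows "sup_norm_on K (p * q) \<le> sup_norm_on K p * sup_norm_on K q"
  using assms
  by (intro sup_norm_on_le)
    (auto simp: norm_mult intro!: mult_mono cmod_poly_le_sup_norm_on sup_norm_on_nonneg)

text \<open>
  Boundedness on an infinite set of points is enough for compactness: dividing out \<open>x - a\<close> for one
  point \<open>a\<close> lowers the degree and keeps the remaining values bounded, so no estimate of coefficients
  is needed.
\<close>

lemma poly_subsequence_pointwise_convergent:
  fixes p :: "nat \<Rightarrow> complex poly"
  assumes "infinite A" "\<And>m. degree (p m) \<le> n"
    and "\<And>x. x \<in> A \<Longrightarrow> bounded (range (\<lambda>m. poly (p m) x))"
  shows "\<exists>r q. strict_mono r \<and> degree q \<le> n \<and> (\<forall>x. (\<lambda>m. poly (p (r m)) x) \<longlonglongrightarrow> poly q x)"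
  using assms
proof (induction n arbitrary: p A)
  case 0
  from \<open>infinite A\<close> obtain a where "a \<in> A"
    by (metis finite.emptyI ex_in_conv)
  have const: "poly (p m) x = poly (p m) a" for m x
    using "0.prems"(2)[of m] by (auto elim!: degree_eq_zeroE)
  from bounded_imp_convergent_subsequence[OF "0.prems"(3)[OF \<open>a \<in> A\<close>]]
  obtain c r where "strict_mono r" "((\<lambda>m. poly (p m) a) \<circ> r) \<longlonglongrightarrow> c"
    by blast
  moreover have "(\<lambda>m. poly (p (r m)) x) = (\<lambda>m. poly (p m) a) \<circ> r" for x
    by (rule ext) (simp only: o_def, rule const)
  ultimately show ?case
    by (intro exI[of _ r] exI[of _ "[:c:]"]) simp
next
  case (Suc n)
  from \<open>infinite A\<close> obtain a where a: "a \<in> A"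
    by (metis finite.emptyI ex_in_conv)
  from bounded_imp_convergent_subsequence[OF Suc.prems(3)[OF a]]
  obtain c r where r: "strict_mono r" and c: "((\<lambda>m. poly (p m) a) \<circ> r) \<longlonglongrightarrow> c"
    by blast
  define g where "g m = synthetic_div (p (r m)) a" for m
  have g: "p (r m) = [:-a, 1:] * g m + [:poly (p (r m)) a:]" for m
    unfolding g_def by (rule synthetic_div_correct'[symmetric])
  have "bounded (range (\<lambda>m. poly (g m) x))" if x: "x \<in> A - {a}" for x
  proof -
    obtain B where B: "\<And>m. cmod (poly (p m) x) \<le> B"
      using Suc.prems(3)[of x] x by (auto simp: bounded_iff)
    obtain B' where B': "\<And>m. cmod (poly (p m) a) \<le> B'"
      using Suc.prems(3)[OF a] unfolding bounded_iff by blast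
    have "cmod (poly (g m) x) \<le> (B + B') / cmod (x - a)" for m
    proof -
      have "poly (p (r m)) x - poly (p (r m)) a = (x - a) * poly (g m) x"
        by (subst g) (simp add: algebra_simps)
      then have "cmod (x - a) * cmod (poly (g m) x) \<le> B + B'"
        by (metis norm_mult norm_triangle_ineq4 B B' add_mono order_trans)
      then show ?thesis
        using x by (simp add: field_simps)
    qed
    then show ?thesis
      by (auto simp: bounded_iff)
  qed
  moreover have "degree (g m) \<le> n" for m
    using Suc.prems(2)[of "r m"] by (simp add: g_def degree_synthetic_div)
  moreover have "infinite (A - {a})"
    using \<open>infinite A\<close> by simp
  ultimately obtain s q where s: "strict_mono s" and q: "degree q \<le> n"
      "\<And>x. (\<lambda>m. poly (g (s m)) x) \<longlonglongrightarrow> poly q x"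
    using Suc.IH[of "A - {a}" g] by blast
  have "(\<lambda>m. poly (p (r (s m))) x) \<longlonglongrightarrow> poly ([:-a, 1:] * q + [:c:]) x" for x
  proof -
    have "(\<lambda>m. poly (p (r (s m))) a) \<longlonglongrightarrow> c"
      using LIMSEQ_subseq_LIMSEQ[OF c s] by (simp add: o_def)
    then have "(\<lambda>m. (x - a) * poly (g (s m)) x + poly (p (r (s m))) a) \<longlonglongrightarrow> (x - a) * poly q x + c"
      by (intro tendsto_intros q(2))
    moreover have "(x - a) * poly (g (s m)) x + poly (p (r (s m))) a = poly (p (r (s m))) x" for m
      by (subst (2) g) (simp add: algebra_simps)
    ultimately show ?thesis
      by (simp add: algebra_simps)
  qed
  moreover have "degree ([:-a, 1:] * q + [:c:]) \<le> Suc n"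
    using q(1) degree_mult_le[of "[:-a, 1:]" q] by (intro degree_add_le) auto
  moreover have "strict_mono (r \<circ> s)"
    using r s by (rule strict_mono_o)
  ultimately show ?case
    by (intro exI[of _ "r \<circ> s"] exI[of _ "[:-a, 1:] * q + [:c:]"] conjI allI)
      (simp_all only: o_def)
qed

text \<open>
  Turns the two conditions on a monic polynomial into a single degree bound, which is preserved under
  limits of the lower-order part.
\<close>

lemma monic_iff_degree_diff_monom:
  fixes p :: "complex poly"
  assumes "0 < n"
  shows "degree p = n \<and> lead_coeff p = 1 \<longleftrightarrow> degree (p - monom 1 n) < n"
proof
  assume "degree p = n \<and> lead_coeff p = 1"
  then have "degree p = n" "coeff p n = 1" by auto
  then show "degree (p - monom 1 n) < n"
    using assms by (intro degree_lessI) (auto simp: coeff_eq_0)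
next
  assume "degree (p - monom 1 n) < n"
  then have coeff: "coeff p i = coeff (monom 1 n) i" if "n \<le> i" for i
    using coeff_eq_0[of "p - monom 1 n" i] that by simp
  have "degree p \<le> n"
    by (rule degree_le) (simp add: coeff)
  moreover have "n \<le> degree p"
    by (rule le_degree) (simp add: coeff)
  ultimately show "degree p = n \<and> lead_coeff p = 1"
    using coeff[of n] by simp
qed

lemma interpolating_poly_exists:
  fixes f :: "complex \<Rightarrow> complex"
  assumes "finite E"
  shows "\<exists>p. degree p \<le> card E - 1 \<and> (\<forall>x\<in>E. poly p x = f x)"
  using assms
proof (induction E)
  case (insert a E)
  then obtain p where p: "degree p \<le> card E - 1" "\<And>x. x \<in> E \<Longrightarrow> poly p x = f x"
    by auto
  define w where "w = (\<Prod>x\<in>E. [:-x, 1:])"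
  have "degree w = card E"
    unfolding w_def by (subst degree_prod_eq_sum_degree) auto
  have w0: "poly w x = 0 \<longleftrightarrow> x \<in> E" for x
    using insert.hyps by (auto simp: w_def poly_prod)
  define c where "c = (f a - poly p a) / poly w a"
  have "degree (p + smult c w) \<le> card E"
    using p(1) \<open>degree w = card E\<close> by (intro degree_add_le) (auto intro: order_trans[OF degree_smult_le])
  moreover have "poly (p + smult c w) x = f x" if "x \<in> insert a E" for x
  proof (cases "x = a")
    case True
    then show ?thesis
      using w0[of a] insert.hyps by (simp add: c_def)
  next
    case False
    then show ?thesis
      using w0[of x] p(2)[of x] that by simp
  qed
  ultimately show ?case
    using insert.hyps by (intro exI[of _ "p + smult c w"]) auto
qed (auto intro: exI[of _ 0])

lemma chebyshev_poly_exists: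
  assumes "compact K" "infinite K" "0 < n"
  shows "\<exists>p. is_chebyshev_poly K n p"
proof -
  have "K \<noteq> {}" using assms by auto
  define M where "M = {p :: complex poly. degree p = n \<and> lead_coeff p = 1}"
  define \<tau> where "\<tau> = (INF p\<in>M. sup_norm_on K p)"
  have bdd: "bdd_below (sup_norm_on K ` M)"
    using sup_norm_on_nonneg[OF assms(1) \<open>K \<noteq> {}\<close>] by (auto simp: bdd_below_def)
  have "monom 1 n \<in> M"
    by (simp add: M_def degree_monom_eq)
  then have "\<exists>p\<in>M. sup_norm_on K p < \<tau> + inverse (real (Suc m))" for m
    using cINF_less_iff[OF _ bdd, of "\<tau> + inverse (real (Suc m))"] by (auto simp: \<tau>_def)
  then obtain p where p: "\<And>m. p m \<in> M" "\<And>m. sup_norm_on K (p m) < \<tau> + inverse (real (Suc m))"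
    by metis
  define g where "g m = p m - monom 1 n" for m
  have deg_g: "degree (g m) < n" for m
    using p(1)[of m] monic_iff_degree_diff_monom[OF assms(3), of "p m"] by (simp add: g_def M_def)
  have "degree (g m) \<le> n - 1" for m
    using deg_g[of m] by simp
  moreover have "bounded (range (\<lambda>m. poly (g m) x))" if "x \<in> K" for x
  proof -
    have "cmod (poly (p m) x) \<le> \<tau> + 1" for m
      using cmod_poly_le_sup_norm_on[OF assms(1) that, of "p m"] p(2)[of m] inverse_le_1_iff[of "real (Suc m)"]
      by linarith
    then have "cmod (poly (g m) x) \<le> \<tau> + 1 + cmod (poly (monom 1 n) x)" for m
      unfolding g_def poly_diff by (meson norm_triangle_ineq4 add_right_mono order_trans)
    then show ?thesis
      by (auto simp: bounded_iff)
  qed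
  ultimately obtain r q where r: "strict_mono r" and q: "degree q \<le> n - 1"
      "\<And>x. (\<lambda>m. poly (g (r m)) x) \<longlonglongrightarrow> poly q x"
    using poly_subsequence_pointwise_convergent[OF assms(2), of g "n - 1"] by blast
  define P where "P = q + monom 1 n"
  have "P \<in> M"
    using monic_iff_degree_diff_monom[OF assms(3), of P] q(1) assms(3) by (simp add: M_def P_def)
  have "sup_norm_on K P \<le> \<tau>"
  proof (rule sup_norm_on_le[OF \<open>K \<noteq> {}\<close>])
    fix z assume z: "z \<in> K"
    have "(\<lambda>m. poly (p (r m)) z) \<longlonglongrightarrow> poly P z"
      using tendsto_add[OF q(2)[of z] tendsto_const[of "poly (monom 1 n) z"]]
      by (simp add: g_def P_def)
    moreover have "(\<lambda>m. \<tau> + inverse (real (Suc (r m)))) \<longlonglongrightarrow> \<tau>"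
      using LIMSEQ_subseq_LIMSEQ[OF LIMSEQ_inverse_real_of_nat_add r] by (simp add: o_def)
    moreover have "cmod (poly (p (r m)) z) \<le> \<tau> + inverse (real (Suc (r m)))" for m
      using cmod_poly_le_sup_norm_on[OF assms(1) z, of "p (r m)"] p(2)[of "r m"] by linarith
    ultimately show "cmod (poly P z) \<le> \<tau>"
      by (intro LIMSEQ_le[OF tendsto_norm]) auto
  qed
  moreover have "\<tau> \<le> sup_norm_on K f" if "f \<in> M" for f
    unfolding \<tau>_def using bdd that by (rule cINF_lower)
  ultimately show ?thesis
    using \<open>P \<in> M\<close> by (intro exI[of _ P]) (fastforce simp: is_chebyshev_poly_def is_arg_min_def M_def)
qed

text \<open>
  The classical extremality criterion: a polynomial with few extremal points is not of least norm.
  Let \<open>h\<close> interpolate \<open>f\<close> at the extremal points. Then \<open>f - \<epsilon> * h = (1 - \<epsilon>) * f + \<epsilon> * (f - h)\<close> is smaller than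
  \<open>f\<close> near those points, where \<open>f - h\<close> is small, while away from them \<open>f\<close> has room to spare and a small
  \<open>\<epsilon>\<close> does no harm.
\<close>

lemma sup_norm_on_decreasable:
  assumes K: "compact K" "infinite K" and "0 < n" and "degree f = n"
    and fin: "finite {z \<in> K. cmod (poly f z) = sup_norm_on K f}"
    and card: "card {z \<in> K. cmod (poly f z) = sup_norm_on K f} \<le> n"
  shows "\<exists>g. degree g < n \<and> sup_norm_on K (f - g) < sup_norm_on K f"
proof -
  define M where "M = sup_norm_on K f"
  define E where "E = {z \<in> K. cmod (poly f z) = M}"
  have "K \<noteq> {}" using K by auto
  have "f \<noteq> 0" using assms(3,4) by auto
  then have "0 < M"
    unfolding M_def by (intro sup_norm_on_pos K)
  obtain h where h: "degree h \<le> card E - 1" "\<And>x. x \<in> E \<Longrightarrow> poly h x = poly f x"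
    using interpolating_poly_exists[of E "poly f"] fin by (auto simp: E_def M_def)
  define U where "U = {z. cmod (poly f z - poly h z) < M / 2}"
  have "open U"
    unfolding U_def by (intro open_Collect_less continuous_intros)
  then have "compact (K - U)"
    using K(1) by (rule compact_diff[rotated])
  obtain M' where M': "M' < M" "\<And>z. z \<in> K - U \<Longrightarrow> cmod (poly f z) \<le> M'"
  proof (cases "K - U = {}")
    case True
    then show ?thesis
      using that[of "M - 1"] by auto
  next
    case False
    have "continuous_on (K - U) (\<lambda>z. cmod (poly f z))"
      by (intro continuous_intros)
    from continuous_attains_sup[OF \<open>compact (K - U)\<close> False this] obtain z
      where z: "z \<in> K - U" "\<And>y. y \<in> K - U \<Longrightarrow> cmod (poly f y) \<le> cmod (poly f z)"
      by blast
    have "z \<notin> E"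
      using z(1) h(2)[of z] \<open>0 < M\<close> by (auto simp: U_def)
    then have "cmod (poly f z) < M"
      using z(1) cmod_poly_le_sup_norm_on[OF K(1), of z f] by (fastforce simp: E_def M_def)
    with z(2) that show ?thesis
      by blast
  qed
  define B where "B = sup_norm_on K h"
  have "0 \<le> B"
    unfolding B_def by (intro sup_norm_on_nonneg K \<open>K \<noteq> {}\<close>)
  \<comment> \<open>\<open>\<epsilon> \<le> 1\<close> is for the convex combination near the extremal points; the second bound uses up at
    most half of the gap \<open>M - M'\<close> elsewhere. \<open>B + 1\<close> avoids a division by zero.\<close>
  define \<epsilon> where "\<epsilon> = min 1 ((M - M') / (2 * (B + 1)))"
  have \<epsilon>: "0 < \<epsilon>" "\<epsilon> \<le> 1"
    using \<open>0 \<le> B\<close> M'(1) by (auto simp: \<epsilon>_def)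
  have "\<epsilon> * B \<le> (M - M') / 2"
  proof -
    have "\<epsilon> * B \<le> (M - M') / (2 * (B + 1)) * B"
      using \<open>0 \<le> B\<close> by (intro mult_right_mono) (auto simp: \<epsilon>_def)
    also have "\<dots> \<le> (M - M') / 2"
      using \<open>0 \<le> B\<close> M'(1) by (simp add: field_simps)
    finally show ?thesis .
  qed
  define g where "g = smult (of_real \<epsilon>) h"
  have *: "cmod (poly (f - g) z) \<le> max (M - \<epsilon> * M / 2) ((M + M') / 2)" if z: "z \<in> K" for z
  proof (cases "z \<in> U")
    case True
    have "poly (f - g) z = of_real (1 - \<epsilon>) * poly f z + of_real \<epsilon> * (poly f z - poly h z)"
      by (simp add: g_def algebra_simps)
    also have "cmod \<dots> \<le> (1 - \<epsilon>) * cmod (poly f z) + \<epsilon> * cmod (poly f z - poly h z)"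
      using \<epsilon> by (intro order_trans[OF norm_triangle_ineq]) (simp add: norm_mult del: of_real_diff)
    also have "\<dots> \<le> (1 - \<epsilon>) * M + \<epsilon> * (M / 2)"
      using \<epsilon> True cmod_poly_le_sup_norm_on[OF K(1) z, of f]
      by (intro add_mono mult_left_mono) (auto simp: U_def M_def)
    also have "\<dots> = M - \<epsilon> * M / 2"
      by (simp add: algebra_simps)
    finally show ?thesis by simp
  next
    case False
    have "cmod (poly (f - g) z) \<le> cmod (poly f z) + \<epsilon> * cmod (poly h z)"
      using norm_triangle_ineq4[of "poly f z" "poly g z"] \<epsilon> by (simp add: g_def norm_mult)
    also have "\<dots> \<le> M' + \<epsilon> * B"
      using z False M'(2)[of z] \<epsilon> cmod_poly_le_sup_norm_on[OF K(1) z, of h]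
      by (intro add_mono mult_left_mono) (auto simp: B_def)
    also have "\<dots> \<le> (M + M') / 2"
      using \<open>\<epsilon> * B \<le> (M - M') / 2\<close> by (simp add: field_simps)
    finally show ?thesis by (rule max.coboundedI2)
  qed
  have "sup_norm_on K (f - g) \<le> max (M - \<epsilon> * M / 2) ((M + M') / 2)"
    using \<open>K \<noteq> {}\<close> * by (rule sup_norm_on_le)
  also have "\<dots> < M"
    using \<epsilon> \<open>0 < M\<close> M'(1) by simp
  finally have "sup_norm_on K (f - g) < M" .
  moreover have "degree g < n"
    using h(1) card \<open>0 < n\<close> degree_smult_le[of "of_real \<epsilon>" h] by (auto simp: g_def E_def M_def)
  ultimately show ?thesis
    unfolding M_def by blast
qed

text \<open>
  Strict convexity of the norm, from the parallelogram law.
\<close>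

lemma norm_add_eq_imp_eq:
  fixes u v :: "'a::real_inner"
  assumes "norm u \<le> r" "norm v \<le> r" "norm (u + v) = 2 * r"
  shows "u = v"
proof -
  have "0 \<le> r"
    using assms(1) norm_ge_zero order_trans by blast
  have "(norm (u - v))\<^sup>2 = 2 * (norm u)\<^sup>2 + 2 * (norm v)\<^sup>2 - (norm (u + v))\<^sup>2"
    by (simp add: power2_norm_eq_inner algebra_simps inner_commute)
  also have "\<dots> \<le> 2 * r\<^sup>2 + 2 * r\<^sup>2 - (2 * r)\<^sup>2"
    using power_mono[OF assms(1) norm_ge_zero, of 2] power_mono[OF assms(2) norm_ge_zero, of 2]
    by (simp add: assms(3))
  also have "\<dots> = 0" by (simp add: power2_eq_square)
  finally show ?thesis by simp
qed

text \<open>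
  The mean of two minimizers is again a minimizer, and by strict convexity the two agree at all of its
  extremal points. If they are distinct, these points are zeros of their difference, so there
  are too few of them for the mean to be minimal.
\<close>

lemma chebyshev_poly_unique:
  assumes K: "compact K" "infinite K" and "0 < n"
    and p: "is_chebyshev_poly K n p" and q: "is_chebyshev_poly K n q"
  shows "p = q"
proof -
  have "K \<noteq> {}" using K by auto
  have deg: "degree p = n" "degree q = n" and lead: "coeff p n = 1" "coeff q n = 1"
    and min: "\<And>f. degree f = n \<Longrightarrow> coeff f n = 1 \<Longrightarrow> sup_norm_on K p \<le> sup_norm_on K f"
    and qp: "sup_norm_on K q \<le> sup_norm_on K p"
    using p q by (auto simp: is_chebyshev_poly_def is_arg_min_def not_less)
  define \<tau> where "\<tau> = sup_norm_on K p"
  define f where "f = smult (1/2) (p + q)"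
  have dp: "degree (p - monom 1 n) < n" "degree (q - monom 1 n) < n"
    using deg lead monic_iff_degree_diff_monom[OF \<open>0 < n\<close>, of p]
      monic_iff_degree_diff_monom[OF \<open>0 < n\<close>, of q] by auto
  have cf: "coeff f i = (coeff p i + coeff q i) / 2" for i
    by (simp add: f_def)
  have f: "degree f = n" "coeff f n = 1"
  proof -
    show "coeff f n = 1"
      by (simp add: cf lead)
    have "degree f \<le> n"
      by (rule degree_le) (auto simp: cf coeff_eq_0 deg)
    moreover have "n \<le> degree f"
      by (rule le_degree) (simp add: \<open>coeff f n = 1\<close>)
    ultimately show "degree f = n" by simp
  qed
  have bound: "cmod (poly p z) \<le> \<tau>" "cmod (poly q z) \<le> \<tau>" if "z \<in> K" for z
    using cmod_poly_le_sup_norm_on[OF K(1) that] qp unfolding \<tau>_def by (blast intro: order_trans)+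
  have pf: "poly f z = (poly p z + poly q z) / 2" for z
    by (simp add: f_def)
  have "sup_norm_on K f \<le> \<tau>"
  proof (rule sup_norm_on_le[OF \<open>K \<noteq> {}\<close>])
    fix z assume "z \<in> K"
    then have "cmod (poly p z + poly q z) \<le> \<tau> + \<tau>"
      using bound norm_triangle_ineq by (blast intro: order_trans add_mono)
    then show "cmod (poly f z) \<le> \<tau>"
      by (simp add: pf norm_divide)
  qed
  with min[OF f] have nf: "sup_norm_on K f = \<tau>"
    by (simp add: \<tau>_def)
  define E where "E = {z \<in> K. cmod (poly f z) = sup_norm_on K f}"
  have E_eq: "poly p z = poly q z" if "z \<in> E" for z
  proof (rule norm_add_eq_imp_eq[of _ \<tau>])
    show "cmod (poly p z + poly q z) = 2 * \<tau>"
      using that by (simp add: E_def nf pf norm_divide field_simps)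
  qed (use that bound in \<open>auto simp: E_def\<close>)
  show ?thesis
  proof (rule ccontr)
    assume "p \<noteq> q"
    then have nz: "p - q \<noteq> 0" by simp
    have sub: "E \<subseteq> {z. poly (p - q) z = 0}"
      using E_eq by auto
    then have fin: "finite E"
      using poly_roots_finite[OF nz] finite_subset by blast
    have "card E \<le> card {z. poly (p - q) z = 0}"
      using sub poly_roots_finite[OF nz] by (intro card_mono)
    also have "\<dots> \<le> degree (p - q)"
      using nz by (rule card_poly_roots_bound)
    also have "\<dots> \<le> n"
      using deg by (metis degree_diff_le order_refl)
    finally obtain g where g: "degree g < n" "sup_norm_on K (f - g) < \<tau>"
      using sup_norm_on_decreasable[OF K \<open>0 < n\<close> f(1)] fin nf unfolding E_def by auto
    have "coeff (f - g) n = 1"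
      using g(1) f(2) by (simp add: coeff_eq_0)
    moreover have "degree (f - g) = n"
      using degree_add_eq_left[of "- g" f] f(1) g(1) by simp
    ultimately show False
      using min[of "f - g"] g(2) by (simp add: \<tau>_def)
  qed
qed

text \<open>
  Justifies the definite description in the definition of the Chebyshev polynomial.
\<close>

lemma chebyshev_poly_minimal:
  assumes "compact K" "infinite K" "0 < n"
  shows "degree (chebyshev_poly K n) = n" "lead_coeff (chebyshev_poly K n) = 1"
    and "degree q = n \<Longrightarrow> lead_coeff q = 1 \<Longrightarrow> sup_norm_on K (chebyshev_poly K n) \<le> sup_norm_on K q"
proof -
  have "is_chebyshev_poly K n (chebyshev_poly K n)"
    unfolding chebyshev_poly_def
    using chebyshev_poly_exists[OF assms] chebyshev_poly_unique[OF assms] by (metis theI)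
  then show "degree (chebyshev_poly K n) = n" "lead_coeff (chebyshev_poly K n) = 1"
    and "degree q = n \<Longrightarrow> lead_coeff q = 1 \<Longrightarrow> sup_norm_on K (chebyshev_poly K n) \<le> sup_norm_on K q"
    by (auto simp: is_chebyshev_poly_def is_arg_min_def not_less)
qed

section \<open>Cantor measures on uniformly perfect sets\<close>

lemma geometric_steps_convergent:
  fixes x :: "nat \<Rightarrow> 'a::complete_space"
  assumes "0 \<le> c" "0 < q" "q < 1" and step: "\<And>k. dist (x (Suc k)) (x k) \<le> c * q ^ k"
  shows "convergent x" and "dist (lim x) (x k) \<le> c * q ^ k / (1 - q)"
proof -
  have part: "dist (x (k + m)) (x k) \<le> c * q ^ k * (1 - q ^ m) / (1 - q)" for k m
  proof (induction m)
    case (Suc m)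
    have "dist (x (k + Suc m)) (x k) \<le> c * q ^ (k + m) + c * q ^ k * (1 - q ^ m) / (1 - q)"
      using dist_triangle[of "x (k + Suc m)" "x k" "x (k + m)"] Suc step[of "k + m"] by simp
    also have "\<dots> = c * q ^ k * (1 - q ^ Suc m) / (1 - q)"
      using assms(3) by (simp add: field_simps power_add)
    finally show ?case .
  qed simp
  have bound: "dist (x (k + m)) (x k) \<le> c * q ^ k / (1 - q)" for k m
    by (rule order_trans[OF part])
      (use assms in \<open>auto intro!: divide_right_mono mult_left_le mult_nonneg_nonneg\<close>)
  have lim0: "(\<lambda>k. c * q ^ k / (1 - q)) \<longlonglongrightarrow> 0"
    using assms by (auto intro!: tendsto_eq_intros LIMSEQ_realpow_zero)
  have "Cauchy x"
  proof (rule metric_CauchyI)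
    fix e :: real assume "0 < e"
    with lim0 obtain N where N: "c * q ^ N / (1 - q) < e / 2"
      by (metis (no_types, lifting) half_gt_zero order_tendstoD(2) eventually_happens' sequentially_bot)
    have "dist (x m) (x n) < e" if "m \<ge> N" "n \<ge> N" for m n
    proof -
      have "dist (x m) (x N) \<le> c * q ^ N / (1 - q)" "dist (x n) (x N) \<le> c * q ^ N / (1 - q)"
        using bound[of N "m - N"] bound[of N "n - N"] that by simp_all
      with N show ?thesis
        using dist_triangle2[of "x m" "x n" "x N"] by linarith
    qed
    then show "\<exists>M. \<forall>m\<ge>M. \<forall>n\<ge>M. dist (x m) (x n) < e"
      by blast
  qed
  then show conv: "convergent x"
    by (rule Cauchy_convergent)
  then have "(\<lambda>m. x (m + k)) \<longlonglongrightarrow> lim x"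
    by (simp add: convergent_LIMSEQ_iff LIMSEQ_ignore_initial_segment)
  then have "(\<lambda>m. dist (x (m + k)) (x k)) \<longlonglongrightarrow> dist (lim x) (x k)"
    by (intro tendsto_intros)
  then show "dist (lim x) (x k) \<le> c * q ^ k / (1 - q)"
    by (rule LIMSEQ_le_const2) (use bound[of k] in \<open>auto simp: add.commute\<close>)
qed

definition binary_prefix :: "nat \<Rightarrow> real \<Rightarrow> nat" where
  "binary_prefix k t = nat \<lfloor>2 ^ k * t\<rfloor>"

lemma binary_prefix_Suc_div_2: "binary_prefix (Suc k) t div 2 = binary_prefix k t"
proof -
  have "\<lfloor>2 ^ k * t\<rfloor> = \<lfloor>2 ^ Suc k * t\<rfloor> div 2"
    using floor_divide_real_eq_div[of 2 "2 ^ Suc k * t"] by simp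
  then show ?thesis
    by (simp add: binary_prefix_def nat_div_distrib')
qed

lemma measurable_binary_prefix [measurable]:
  "binary_prefix k \<in> borel \<rightarrow>\<^sub>M count_space UNIV"
  unfolding binary_prefix_def by measurable

lemma emeasure_binary_prefix:
  "emeasure lborel ({0..<1} \<inter> {t. binary_prefix k t = m}) \<le> ennreal ((1/2) ^ k)"
proof -
  have "emeasure lborel ({0..<1} \<inter> {t. binary_prefix k t = m})
      \<le> emeasure lborel {real m / 2 ^ k..(real m + 1) / 2 ^ k}"
  proof (rule emeasure_mono)
    show "{0..<1} \<inter> {t. binary_prefix k t = m} \<subseteq> {real m / 2 ^ k..(real m + 1) / 2 ^ k}"
    proof safe
      fix t :: real assume t: "t \<in> {0..<1}" "m = binary_prefix k t"
      then have "int m = \<lfloor>2 ^ k * t\<rfloor>"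
        by (simp add: binary_prefix_def)
      then have "real m \<le> 2 ^ k * t \<and> 2 ^ k * t < real m + 1"
        by linarith
      then have "t \<in> {real m / 2 ^ k..(real m + 1) / 2 ^ k}"
        by (simp add: field_simps)
      with t(2) show "t \<in> {real (binary_prefix k t) / 2 ^ k..(real (binary_prefix k t) + 1) / 2 ^ k}"
        by simp
    qed
  qed simp
  also have "\<dots> = ennreal ((1/2) ^ k)"
  proof -
    have "(real m + 1) / 2 ^ k - real m / 2 ^ k = (1/2) ^ k"
      by (simp add: add_divide_distrib power_one_over)
    then show ?thesis
      by (subst emeasure_lborel_Icc) (auto simp: divide_right_mono)
  qed
  finally show ?thesis .
qed

text \<open>
  Node \<open>m\<close> of level \<open>k\<close> has the children \<open>2 * m\<close>, which repeats its point, and \<open>2 * m + 1\<close>, which moves it to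
  a nearby point chosen by \<open>s k\<close>.
\<close>

primrec binary_tree :: "(nat \<Rightarrow> 'a \<Rightarrow> 'a) \<Rightarrow> 'a \<Rightarrow> nat \<Rightarrow> nat \<Rightarrow> 'a" where
  "binary_tree s z 0 = (\<lambda>m. z)"
| "binary_tree s z (Suc k) =
     (\<lambda>m. if even m then binary_tree s z k (m div 2) else s k (binary_tree s z k (m div 2)))"

lemma binary_tree_in:
  assumes "z \<in> K" "\<And>k x. x \<in> K \<Longrightarrow> s k x \<in> K"
  shows "binary_tree s z k m \<in> K"
  using assms by (induction k arbitrary: m) auto

text \<open>
  The points on level \<open>k\<close> move by at most \<open>r k = R / 2 * q ^ k\<close> with \<open>q = \<gamma> / 8\<close>, and uniform perfectness lets
  siblings be separated by \<open>\<gamma> * r k = 8 * r (k + 1)\<close>. All later moves displace a point by at most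
  \<open>2 * r (k + 1)\<close>, so the ends of different branches stay \<open>4 * r (k + 1) = 2 * R * q ^ (k + 1)\<close> apart, and a
  ball of radius \<open>R * q ^ k\<close> meets a single branch of level \<open>k\<close>. The measure is the image of Lebesgue measure on
  the unit interval under the map that follows the binary digits of \<open>t\<close> through the tree.
\<close>

lemma cantor_measure_exists:
  fixes K :: "complex set"
  assumes "compact K" "0 < \<gamma>" "\<gamma> < 1" "z \<in> K" "0 < R" "R \<le> diameter K"
    and perfect: "\<And>x r. x \<in> K \<Longrightarrow> 0 < r \<Longrightarrow> r < diameter K \<Longrightarrow> \<exists>y\<in>K. \<gamma> * r \<le> dist y x \<and> dist y x \<le> r"
  shows "\<exists>\<mu>\<in>prob_measures_on K. emeasure \<mu> (K \<inter> cball z R) = 1 \<and>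
           (\<forall>w k. emeasure \<mu> (ball w (R * (\<gamma> / 8) ^ k)) \<le> ennreal ((1/2) ^ k))"
proof -
  define q where "q = \<gamma> / 8"
  have q: "0 < q" "q < 1/8" "\<gamma> = 8 * q"
    using assms(2,3) by (auto simp: q_def)
  define r where "r k = R / 2 * q ^ k" for k
  have r: "0 < r k" "r k \<le> R / 2" "r (Suc k) = q * r k" for k
    using q assms(5) by (auto simp: r_def intro!: mult_left_le power_le_one)
  have r_less: "r k < diameter K" for k
    using r(2)[of k] assms(5,6) by linarith
  define s where "s k x = (SOME y. y \<in> K \<and> \<gamma> * r k \<le> dist y x \<and> dist y x \<le> r k)" for k x
  have s: "\<And>k x. x \<in> K \<Longrightarrow> s k x \<in> K"
      "\<And>k x. x \<in> K \<Longrightarrow> \<gamma> * r k \<le> dist (s k x) x" "\<And>k x. x \<in> K \<Longrightarrow> dist (s k x) x \<le> r k"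
  proof -
    have "s k x \<in> K \<and> \<gamma> * r k \<le> dist (s k x) x \<and> dist (s k x) x \<le> r k" if "x \<in> K" for k x
      unfolding s_def by (rule someI_ex) (use perfect[OF that r(1) r_less] in blast)
    then show "\<And>k x. x \<in> K \<Longrightarrow> s k x \<in> K" "\<And>k x. x \<in> K \<Longrightarrow> \<gamma> * r k \<le> dist (s k x) x"
        "\<And>k x. x \<in> K \<Longrightarrow> dist (s k x) x \<le> r k"
      by blast+
  qed
  define Y where "Y k t = binary_tree s z k (binary_prefix k t)" for k t
  have YK: "Y k t \<in> K" for k t
    unfolding Y_def by (rule binary_tree_in) (auto simp: assms(4) s(1))
  have Y_Suc: "Y (Suc k) t = (if even (binary_prefix (Suc k) t) then Y k t else s k (Y k t))" for k t
    by (simp add: Y_def binary_prefix_Suc_div_2)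
  have Y_step: "dist (Y (Suc k) t) (Y k t) \<le> R / 2 * q ^ k" for k t
    using s(3)[OF YK, of k k t] r(1)[of k] by (auto simp: Y_Suc r_def)
  define X where "X t = lim (\<lambda>k. Y k t)" for t
  have conv: "convergent (\<lambda>k. Y k t)" and dist_le: "dist (X t) (Y k t) \<le> R / 2 * q ^ k / (1 - q)" for t k
    using geometric_steps_convergent[of "R / 2" q "\<lambda>k. Y k t"] Y_step q assms(5) unfolding X_def by auto
  have XY: "dist (X t) (Y k t) \<le> 2 * r k" for t k
  proof -
    have "r k / (1 - q) \<le> r k / (1 / 2)"
      using q r(1)[of k] by (intro divide_left_mono) auto
    with dist_le[of t k] show ?thesis by (simp add: r_def)
  qed
  have XK: "X t \<in> K" for t
    using conv[of t] closed_sequentially[OF compact_imp_closed[OF assms(1)]] YK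
    unfolding X_def convergent_LIMSEQ_iff by metis
  \<comment> \<open>Branches that separate at an earlier level are even further apart, since \<open>r\<close> decreases.\<close>
  have sep: "4 * r k \<le> dist (X t) (X t')"
    if "t \<in> {0..<1}" "t' \<in> {0..<1}" "binary_prefix k t \<noteq> binary_prefix k t'" for k t t'
    using that(3)
  proof (induction k)
    case 0
    with that(1,2) show ?case
      by (simp add: binary_prefix_def floor_eq_iff)
  next
    case (Suc k)
    show ?case
    proof (cases "binary_prefix k t = binary_prefix k t'")
      case False
      with Suc.IH have "4 * r k \<le> dist (X t) (X t')" .
      moreover have "r (Suc k) \<le> r k"
        using q r(1)[of k] by (simp add: r(3) mult_le_cancel_right1)
      ultimately show ?thesis by simp
    next
      case True
      then have YY: "Y k t = Y k t'"
        by (simp add: Y_def)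
      have "even (binary_prefix (Suc k) t) \<noteq> even (binary_prefix (Suc k) t')"
        using Suc.prems True binary_prefix_Suc_div_2[of k t] binary_prefix_Suc_div_2[of k t']
        by presburger
      then have "\<gamma> * r k \<le> dist (Y (Suc k) t) (Y (Suc k) t')"
        using s(2)[OF YK, of k k t] by (auto simp: Y_Suc YY dist_commute)
      then have "8 * r (Suc k) \<le> dist (Y (Suc k) t) (Y (Suc k) t')"
        by (simp add: r(3) q(3))
      also have "\<dots> \<le> dist (X t) (X t') + 4 * r (Suc k)"
        using XY[of t "Suc k"] XY[of t' "Suc k"]
          dist_triangle3[of "Y (Suc k) t" "Y (Suc k) t'" "X t"]
          dist_triangle[of "X t" "Y (Suc k) t'" "X t'"] by linarith
      finally show ?thesis by simp
    qed
  qed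
  define U where "U = uniform_measure lborel {0..<1::real}"
  interpret U: prob_space U
    unfolding U_def by (rule prob_space_uniform_measure) auto
  have sets_U [measurable_cong]: "sets U = sets borel"
    by (simp add: U_def)
  have "Y k \<in> borel_measurable borel" for k
    unfolding Y_def by measurable
  then have X [measurable]: "X \<in> borel_measurable borel"
    unfolding X_def by (intro borel_measurable_lim_metric)
  then have XU [measurable]: "X \<in> borel_measurable U"
    by (simp add: measurable_cong_sets[OF sets_U refl])
  define \<mu> where "\<mu> = distr U borel X"
  interpret \<mu>: prob_space \<mu>
    unfolding \<mu>_def by (rule U.prob_space_distr) (rule XU)
  have emeasure: "emeasure \<mu> B = emeasure lborel ({0..<1} \<inter> X -` B)" if "B \<in> sets borel" for B
  proof -
    have *: "X -` B \<in> sets borel"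
      using measurable_sets[OF X that] by simp
    have "emeasure \<mu> B = emeasure U (X -` B)"
      using that XU by (simp add: \<mu>_def emeasure_distr) (simp add: U_def)
    also have "\<dots> = emeasure lborel ({0..<1} \<inter> X -` B)"
      using * by (simp add: U_def divide_ennreal_def)
    finally show ?thesis .
  qed
  have full: "emeasure \<mu> B = 1" if "B \<in> sets borel" "\<And>t. X t \<in> B" for B
  proof -
    have "{0..<1} \<inter> X -` B = {0..<1}"
      using that(2) by auto
    then show ?thesis
      by (simp add: emeasure[OF that(1)])
  qed
  have KR: "X t \<in> K \<inter> cball z R" for t
    using XK[of t] XY[of t 0] by (simp add: Y_def r_def dist_commute)
  have "K \<in> sets borel"
    using assms(1) by (rule borel_compact)
  have "\<mu> \<in> prob_measures_on K"
    unfolding prob_measures_on_def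
    using full[OF \<open>K \<in> sets borel\<close> XK] \<mu>.prob_space_axioms by (simp add: \<mu>_def)
  moreover have "emeasure \<mu> (K \<inter> cball z R) = 1"
    using \<open>K \<in> sets borel\<close> by (intro full KR) auto
  moreover have "emeasure \<mu> (ball w (R * q ^ k)) \<le> ennreal ((1/2) ^ k)" for w k
  proof (cases "{0..<1} \<inter> X -` ball w (R * q ^ k) = {}")
    case True
    then show ?thesis
      by (simp add: emeasure)
  next
    case False
    then obtain t where "t \<in> {0..<1} \<inter> X -` ball w (R * q ^ k)"
      by blast
    then have t: "t \<in> {0..<1}" "dist w (X t) < R * q ^ k"
      by simp_all
    have "binary_prefix k t' = binary_prefix k t"
      if "t' \<in> {0..<1}" "dist w (X t') < R * q ^ k" for t'
    proof (rule ccontr)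
      assume "binary_prefix k t' \<noteq> binary_prefix k t"
      then have "2 * (R * q ^ k) \<le> dist (X t') (X t)"
        using sep[OF that(1) t(1)] by (simp add: r_def)
      then show False
        using dist_triangle3[of "X t'" "X t" w] t(2) that(2) by linarith
    qed
    then have sub: "{0..<1} \<inter> X -` ball w (R * q ^ k)
        \<subseteq> {0..<1} \<inter> {t'. binary_prefix k t' = binary_prefix k t}"
      by auto
    have "emeasure \<mu> (ball w (R * q ^ k)) = emeasure lborel ({0..<1} \<inter> X -` ball w (R * q ^ k))"
      by (rule emeasure) simp
    also have "\<dots> \<le> emeasure lborel ({0..<1} \<inter> {t'. binary_prefix k t' = binary_prefix k t})"
      using sub by (rule emeasure_mono) measurable
    also have "\<dots> \<le> ennreal ((1/2) ^ k)"
      by (rule emeasure_binary_prefix)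
    finally show ?thesis .
  qed
  ultimately show ?thesis
    unfolding q_def by (intro bexI[of _ \<mu>] conjI allI)
qed

section \<open>Logarithmic potentials of spread measures\<close>

text \<open>
  The factor \<open>D\<close> makes the kernel nonnegative on sets of diameter at most \<open>D\<close>, so all
  potentials and energies are integrals of nonnegative functions, with value \<open>\<infinity>\<close> on the diagonal.
\<close>

definition scaled_log_kernel :: "real \<Rightarrow> complex \<Rightarrow> complex \<Rightarrow> ennreal" where
  "scaled_log_kernel D z w = (if z = w then \<infinity> else ennreal (ln (D / dist z w)))"

lemma scaled_log_kernel_measurable [measurable (raw)]:
  assumes "f \<in> borel_measurable M" "g \<in> borel_measurable M"
  shows "(\<lambda>x. scaled_log_kernel D (f x) (g x)) \<in> borel_measurable M"
  unfolding scaled_log_kernel_def using assms by measurable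

text \<open>
  The part of the kernel beyond \<open>ln (D / R)\<close> is dominated by \<open>ln (1 / q)\<close> times the number of
  balls \<open>ball w (R * q ^ k)\<close> that contain \<open>x\<close>, and these balls have total measure at most \<open>2\<close>.
\<close>

lemma log_potential_le:
  assumes \<mu>: "prob_space \<mu>" "sets \<mu> = sets borel"
    and "0 < R" "R \<le> D" "0 < q" "q < 1"
    and ball: "\<And>k. emeasure \<mu> (ball w (R * q ^ k)) \<le> ennreal ((1/2) ^ k)"
  shows "(\<integral>\<^sup>+ x. scaled_log_kernel D w x \<partial>\<mu>) \<le> ennreal (ln (D / R) + 2 * ln (1 / q))"
proof -
  interpret prob_space \<mu> by fact
  note [measurable_cong] = \<mu>(2)
  define L where "L = ln (1 / q)"
  have "0 < L"
    unfolding L_def using assms(5,6) by simp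
  have nn: "0 \<le> ln (D / R)"
    using assms(3,4) by simp
  let ?S = "\<lambda>x. \<Sum>k. ennreal L * indicator (ball w (R * q ^ k)) x"
  have lower: "ennreal (real n * L) \<le> ?S x" if "\<And>k. k < n \<Longrightarrow> x \<in> ball w (R * q ^ k)" for x n
  proof -
    have "ennreal (real n * L) = (\<Sum>k<n. ennreal L * indicator (ball w (R * q ^ k)) x)"
      using that \<open>0 < L\<close> by (simp add: ennreal_mult ennreal_of_nat_eq_real_of_nat)
    also have "\<dots> \<le> ?S x"
      by (rule sum_le_suminf) auto
    finally show ?thesis .
  qed
  have pointwise: "scaled_log_kernel D w x \<le> ennreal (ln (D / R)) + ?S x" for x
  proof (cases "w = x")
    case True
    have "?S x = \<infinity>"
    proof (rule ccontr)
      assume "?S x \<noteq> \<infinity>"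
      then obtain b where b: "?S x = ennreal b" "0 \<le> b"
        by (cases "?S x") auto
      obtain n where "b < real n * L"
        using reals_Archimedean3[OF \<open>0 < L\<close>] by blast
      moreover have "ennreal (real n * L) \<le> ennreal b"
        using lower[of n x] True assms(3,5) b(1) by simp
      ultimately show False
        using b(2) by (simp add: ennreal_le_iff)
    qed
    then show ?thesis by simp
  next
    case False
    define d where "d = dist w x"
    have "0 < d" using False by (simp add: d_def)
    have "\<exists>n. R * q ^ n \<le> d"
    proof -
      obtain n where "q ^ n < d / R"
        using real_arch_pow_inv[of "d / R" q] \<open>0 < d\<close> assms(3,6) by auto
      then show ?thesis
        using assms(3) by (intro exI[of _ n]) (simp add: field_simps)
    qed
    then obtain n where n: "R * q ^ n \<le> d" "\<And>k. k < n \<Longrightarrow> d < R * q ^ k"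
      using exists_least_iff[of "\<lambda>n. R * q ^ n \<le> d"] by (auto simp: not_le)
    have "ln (D / d) \<le> ln (D / (R * q ^ n))"
      using \<open>0 < d\<close> assms(3-5) n(1) by (intro ln_mono divide_left_mono) auto
    also have "\<dots> = ln (D / R) + real n * L"
      using assms(3-5) by (simp add: L_def ln_div ln_mult ln_realpow algebra_simps)
    finally have "scaled_log_kernel D w x \<le> ennreal (ln (D / R) + real n * L)"
      using False by (simp add: scaled_log_kernel_def d_def ennreal_leI)
    also have "\<dots> = ennreal (ln (D / R)) + ennreal (real n * L)"
      using nn \<open>0 < L\<close> by (intro ennreal_plus) auto
    also have "\<dots> \<le> ennreal (ln (D / R)) + ?S x"
      using n(2) by (intro add_left_mono lower) (auto simp: d_def)
    finally show ?thesis .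
  qed
  have "(\<integral>\<^sup>+ x. scaled_log_kernel D w x \<partial>\<mu>) \<le> (\<integral>\<^sup>+ x. ennreal (ln (D / R)) + ?S x \<partial>\<mu>)"
    by (intro nn_integral_mono pointwise)
  also have "\<dots> = ennreal (ln (D / R)) + (\<Sum>k. ennreal L * emeasure \<mu> (ball w (R * q ^ k)))"
  proof -
    have [measurable]: "ball w e \<in> sets borel" for e
      by simp
    have "(\<integral>\<^sup>+ x. ?S x \<partial>\<mu>) = (\<Sum>k. \<integral>\<^sup>+ x. ennreal L * indicator (ball w (R * q ^ k)) x \<partial>\<mu>)"
      by (rule nn_integral_suminf) measurable
    also have "\<dots> = (\<Sum>k. ennreal L * emeasure \<mu> (ball w (R * q ^ k)))"
      by (intro suminf_cong nn_integral_cmult_indicator) (simp add: \<mu>(2))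
    finally show ?thesis
      by (subst nn_integral_add) (auto simp: emeasure_space_1 simp del: ennreal_suminf_cmult)
  qed
  also have "\<dots> \<le> ennreal (ln (D / R)) + (\<Sum>k. ennreal (L * (1/2) ^ k))"
    using \<open>0 < L\<close> ball by (intro add_left_mono suminf_le) (auto simp: ennreal_mult intro!: mult_left_mono)
  also have "(\<Sum>k. ennreal (L * (1/2) ^ k)) = ennreal (\<Sum>k. L * (1/2) ^ k)"
    using \<open>0 < L\<close> by (intro suminf_ennreal2 summable_mult summable_geometric) auto
  also have "(\<Sum>k. L * (1/2) ^ k) = 2 * L"
    using suminf_mult[of "\<lambda>k. (1/2::real) ^ k" L] suminf_geometric[of "1/2 :: real"]
    by (simp add: summable_geometric)
  also have "ennreal (ln (D / R)) + ennreal (2 * L) = ennreal (ln (D / R) + 2 * L)"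
    using nn \<open>0 < L\<close> by (intro ennreal_plus[symmetric]) auto
  finally show ?thesis
    by (simp add: L_def)
qed

text \<open>
  The effect on the logarithmic kernel of displacing points by a total distance \<open>\<rho>\<close>.
\<close>

lemma ln_div_shift_le:
  fixes D d e \<rho> :: real
  assumes "0 < D" "0 < d" "0 \<le> \<rho>" "\<rho> \<le> d / 2" "d - \<rho> \<le> e"
  shows "ln (D / e) \<le> ln (D / d) + 2 * \<rho> / d"
proof -
  define u where "u = \<rho> / d"
  have u: "0 \<le> u" "u \<le> 1/2"
    using assms by (auto simp: u_def field_simps)
  have "d * (1 - u) = d - \<rho>"
    using assms(2) by (simp add: u_def field_simps)
  moreover have pos: "0 < d * (1 - u)"
    using assms(2) u by simp
  ultimately have "ln (D / e) \<le> ln (D / (d * (1 - u)))"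
    using assms by (intro ln_mono divide_left_mono) auto
  also have "\<dots> = ln (D / d) - ln (1 - u)"
    using assms(1,2) u by (simp add: ln_div ln_mult)
  also have "\<dots> \<le> ln (D / d) + (u + 2 * u\<^sup>2)"
    using ln_one_minus_pos_lower_bound[OF u] by simp
  also have "u + 2 * u\<^sup>2 \<le> 2 * u"
    using u mult_right_mono[OF u(2) u(1)] by (simp add: power2_eq_square)
  finally show ?thesis
    by (simp add: u_def)
qed

lemma log_potential_far_le:
  assumes \<mu>: "prob_space \<mu>" "sets \<mu> = sets borel" and AE: "AE y in \<mu>. dist z y \<le> R"
    and "0 < D" "0 < R" "2 * R \<le> dist z x"
  shows "(\<integral>\<^sup>+ y. scaled_log_kernel D x y \<partial>\<mu>) \<le> ennreal (ln (D / dist z x) + 2 * R / dist z x)"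
proof -
  interpret prob_space \<mu> by fact
  have "(\<integral>\<^sup>+ y. scaled_log_kernel D x y \<partial>\<mu>) \<le> (\<integral>\<^sup>+ y. ennreal (ln (D / dist z x) + 2 * R / dist z x) \<partial>\<mu>)"
  proof (rule nn_integral_mono_AE, use AE in eventually_elim)
    fix y assume "dist z y \<le> R"
    then have y: "dist z x - R \<le> dist x y" "x \<noteq> y"
      using dist_triangle[of z x y] assms(5,6) by (auto simp: dist_commute)
    then show "scaled_log_kernel D x y \<le> ennreal (ln (D / dist z x) + 2 * R / dist z x)"
      using assms(4-6) by (auto simp: scaled_log_kernel_def intro!: ennreal_leI ln_div_shift_le)
  qed
  then show ?thesis
    by (simp add: emeasure_space_1)
qed

section \<open>Leja points\<close>

definition leja_sequence :: "complex set \<Rightarrow> (nat \<Rightarrow> complex) \<Rightarrow> bool" where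
  "leja_sequence K z \<longleftrightarrow>
     (\<forall>k. z k \<in> K \<and> (\<forall>x\<in>K. (\<Prod>j<k. dist x (z j)) \<le> (\<Prod>j<k. dist (z k) (z j))))"

lemma leja_sequence_exists:
  assumes "compact K" "K \<noteq> {}"
  shows "\<exists>z. leja_sequence K z"
  unfolding leja_sequence_def
proof (rule dependent_wf_choice[OF wf_less_than])
  fix f :: "nat \<Rightarrow> complex" and k
  have "continuous_on K (\<lambda>x. \<Prod>j<k. dist x (f j))"
    by (intro continuous_intros)
  from continuous_attains_sup[OF assms this]
  show "\<exists>r. r \<in> K \<and> (\<forall>x\<in>K. (\<Prod>j<k. dist x (f j)) \<le> (\<Prod>j<k. dist r (f j)))"
    by blast
qed auto

lemma sup_norm_on_prod_le_leja:
  assumes "leja_sequence K z"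
  shows "sup_norm_on K (\<Prod>j<k. [:- z j, 1:]) \<le> (\<Prod>j<k. dist (z k) (z j))"
proof (rule sup_norm_on_le)
  show "K \<noteq> {}"
    using assms by (auto simp: leja_sequence_def)
  fix x assume "x \<in> K"
  with assms show "cmod (poly (\<Prod>j<k. [:- z j, 1:]) x) \<le> (\<Prod>j<k. dist (z k) (z j))"
    by (simp add: leja_sequence_def poly_prod prod_norm[symmetric] dist_norm)
qed

text \<open>
  A repeated point would make the maximal product vanish, so a nonzero polynomial would vanish on \<open>K\<close>.
\<close>

lemma leja_sequence_inj:
  assumes "compact K" "infinite K" "leja_sequence K z"
  shows "inj z"
proof -
  have "z j \<noteq> z k" if "j < k" for j k
  proof
    assume eq: "z j = z k"
    have "(\<Prod>j<k. dist (z k) (z j)) = 0"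
      using eq that by (intro prod_zero) (auto intro!: bexI[of _ j])
    moreover have "0 < sup_norm_on K (\<Prod>j<k. [:- z j, 1:])"
      by (intro sup_norm_on_pos assms) auto
    ultimately show False
      using sup_norm_on_prod_le_leja[OF assms(3), of k] by linarith
  qed
  then show ?thesis
    by (metis injI linorder_less_linear)
qed

section \<open>Power separation of Leja points\<close>

lemma ln_doubling_increment:
  fixes d R :: real
  assumes "0 < d" "0 < R"
  shows "R / (d + 2 * R) \<le> ln (1 + 2 * R / d) - ln (1 + R / d)"
proof -
  have "1 + 2 * R / d = (d + 2 * R) / d" "1 + R / d = (d + R) / d"
    using assms by (simp_all add: field_simps)
  then have "ln (1 + 2 * R / d) - ln (1 + R / d) = - ln ((d + R) / (d + 2 * R))"
    using assms by (simp add: ln_div)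
  moreover have "ln ((d + R) / (d + 2 * R)) \<le> (d + R) / (d + 2 * R) - 1"
    using assms by (intro ln_le_minus_one) simp
  moreover have "(d + R) / (d + 2 * R) - 1 = - (R / (d + 2 * R))"
    using assms by (simp add: field_simps)
  ultimately show ?thesis
    by linarith
qed

text \<open>
  This lemma and \<open>ln_doubling_far\<close> are the two termwise inequalities for
  \<open>leja_doubling\<close>. The left side collects the term of \<open>G R\<close> and the most that this point can contribute to
  the excess of the averaged potential over the potential at \<open>z k\<close>. Points nearer than \<open>2 * R\<close> contribute
  through the uniform bound on potentials, with \<open>L = ln (1 / q)\<close>.
\<close>

lemma ln_doubling_near:
  fixes d R L :: real
  assumes "0 < d" "d < 2 * R" "0 \<le> L"
  shows "ln (1 + R / d) + 2 * L + ln (d / R) \<le> (8 + 8 * L) * (ln (1 + 2 * R / d) - ln (1 + R / d))"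
proof -
  have "0 < R" using assms by linarith
  have "1 / 4 \<le> R / (d + 2 * R)"
    using assms \<open>0 < R\<close> by (simp add: field_simps)
  also have "\<dots> \<le> ln (1 + 2 * R / d) - ln (1 + R / d)"
    using assms(1) \<open>0 < R\<close> by (rule ln_doubling_increment)
  finally have "(8 + 8 * L) * (1 / 4) \<le> (8 + 8 * L) * (ln (1 + 2 * R / d) - ln (1 + R / d))"
    using assms(3) by (intro mult_left_mono) auto
  moreover have "ln (1 + R / d) + ln (d / R) = ln (1 + d / R)"
  proof -
    have "1 + R / d = (d + R) / d" "1 + d / R = (d + R) / R"
      using assms(1) \<open>0 < R\<close> by (simp_all add: field_simps)
    then show ?thesis
      using assms(1) \<open>0 < R\<close> by (simp add: ln_div)
  qed
  moreover have "ln (1 + d / R) \<le> d / R"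
    using assms(1) \<open>0 < R\<close> by (intro ln_add_one_self_le_self) simp
  moreover have "d / R \<le> 2"
    using assms(2) \<open>0 < R\<close> by (simp add: field_simps)
  moreover have "(8 + 8 * L) * (1 / 4) = 2 + 2 * L"
    by simp
  ultimately show ?thesis
    by linarith
qed

text \<open>
  Points at distance at least \<open>2 * R\<close> contribute only through the displacement error \<open>2 * R / d\<close>.
\<close>

lemma ln_doubling_far:
  fixes d R L :: real
  assumes "0 < R" "2 * R \<le> d" "0 \<le> L"
  shows "ln (1 + R / d) + 2 * R / d \<le> (8 + 8 * L) * (ln (1 + 2 * R / d) - ln (1 + R / d))"
proof -
  have "0 < d" using assms by linarith
  have "0 \<le> R / (2 * d)"
    using assms(1) \<open>0 < d\<close> by simp
  have "R / (2 * d) \<le> R / (d + 2 * R)"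
    using assms \<open>0 < d\<close> by (intro divide_left_mono) auto
  also have "\<dots> \<le> ln (1 + 2 * R / d) - ln (1 + R / d)"
    using \<open>0 < d\<close> assms(1) by (rule ln_doubling_increment)
  finally have "8 * (R / (2 * d)) \<le> (8 + 8 * L) * (ln (1 + 2 * R / d) - ln (1 + R / d))"
    using assms(3) \<open>0 \<le> R / (2 * d)\<close> by (intro mult_mono) auto
  moreover have "ln (1 + R / d) \<le> R / d"
    using assms(1) \<open>0 < d\<close> by (intro ln_add_one_self_le_self) simp
  moreover have "8 * (R / (2 * d)) = 4 * (R / d)" "2 * R / d = 2 * (R / d)"
    by simp_all
  ultimately show ?thesis
    using \<open>0 \<le> R / (2 * d)\<close> by linarith
qed

text \<open>
  The maximality of Leja points, in logarithmic form.
\<close>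

lemma leja_sum_le_potential:
  assumes leja: "leja_sequence K z" and diam: "\<And>x y. x \<in> K \<Longrightarrow> y \<in> K \<Longrightarrow> dist x y \<le> D"
    and "0 < D" "x \<in> K" and distinct: "\<And>j. j < k \<Longrightarrow> z j \<noteq> z k"
  shows "ennreal (\<Sum>j<k. ln (D / dist (z k) (z j))) \<le> (\<Sum>j<k. scaled_log_kernel D (z j) x)"
proof (cases "\<exists>j<k. z j = x")
  case True
  then obtain j where "j < k" "z j = x"
    by blast
  have "ennreal (\<Sum>j<k. ln (D / dist (z k) (z j))) \<le> scaled_log_kernel D (z j) x"
    using \<open>z j = x\<close> by (simp add: scaled_log_kernel_def)
  also have "\<dots> \<le> (\<Sum>j<k. scaled_log_kernel D (z j) x)"
    using \<open>j < k\<close> by (intro member_le_sum) auto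
  finally show ?thesis .
next
  case False
  have zK: "z j \<in> K" for j
    using leja by (simp add: leja_sequence_def)
  have sum_ln: "(\<Sum>j<k. ln (D / dist y (z j))) = real k * ln D - ln (\<Prod>j<k. dist y (z j))"
    if "\<And>j. j < k \<Longrightarrow> y \<noteq> z j" for y
  proof -
    have "(\<Sum>j<k. ln (D / dist y (z j))) = (\<Sum>j<k. ln D - ln (dist y (z j)))"
      using that \<open>0 < D\<close> by (intro sum.cong) (auto simp: ln_div)
    moreover have "ln (\<Prod>j<k. dist y (z j)) = (\<Sum>j<k. ln (dist y (z j)))"
      using that by (intro ln_prod) auto
    ultimately show ?thesis
      by (simp add: sum_subtractf)
  qed
  have "(\<Prod>j<k. dist x (z j)) \<le> (\<Prod>j<k. dist (z k) (z j))" "0 < (\<Prod>j<k. dist x (z j))"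
    using leja \<open>x \<in> K\<close> False by (auto simp: leja_sequence_def intro!: prod_pos)
  then have "ln (\<Prod>j<k. dist x (z j)) \<le> ln (\<Prod>j<k. dist (z k) (z j))"
    by simp
  then have "(\<Sum>j<k. ln (D / dist (z k) (z j))) \<le> (\<Sum>j<k. ln (D / dist x (z j)))"
    using False distinct by (subst (1 2) sum_ln) force+
  then have "ennreal (\<Sum>j<k. ln (D / dist (z k) (z j))) \<le> ennreal (\<Sum>j<k. ln (D / dist x (z j)))"
    by (rule ennreal_leI)
  also have "\<dots> = (\<Sum>j<k. ennreal (ln (D / dist x (z j))))"
    using diam[OF \<open>x \<in> K\<close> zK] \<open>0 < D\<close> False by (intro sum_ennreal[symmetric]) force
  also have "\<dots> = (\<Sum>j<k. scaled_log_kernel D (z j) x)"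
    using False by (intro sum.cong) (auto simp: scaled_log_kernel_def dist_commute)
  finally show ?thesis .
qed

text \<open>
  Averaging the extremality of \<open>z k\<close> over a spread measure of scale \<open>R\<close> around it: the potential of the earlier
  points at \<open>z k\<close> is at most its average, which is bounded term by term by the spread estimate (near
  points) or the displacement estimate (far points). The function \<open>G\<close> is chosen so that both kinds of terms are
  controlled by its growth from \<open>R\<close> to \<open>2 * R\<close>.
\<close>

lemma leja_doubling:
  assumes leja: "leja_sequence K z" and diam: "\<And>x y. x \<in> K \<Longrightarrow> y \<in> K \<Longrightarrow> dist x y \<le> D"
    and distinct: "\<And>j. j < k \<Longrightarrow> z j \<noteq> z k"
    and R: "0 < R" "R \<le> D" and q: "0 < q" "q < 1"
    and \<mu>: "\<mu> \<in> prob_measures_on K" "AE y in \<mu>. dist (z k) y \<le> R"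
      "\<And>w m. emeasure \<mu> (ball w (R * q ^ m)) \<le> ennreal ((1/2) ^ m)"
  defines "G \<equiv> \<lambda>\<rho>. \<Sum>j<k. ln (1 + \<rho> / dist (z k) (z j))"
  shows "G R \<le> (8 + 8 * ln (1 / q)) * (G (2 * R) - G R)"
proof -
  have prob: "prob_space \<mu>" and sets: "sets \<mu> = sets borel" and \<mu>K: "emeasure \<mu> K = 1"
    using \<mu>(1) by (auto simp: prob_measures_on_def)
  interpret prob_space \<mu> by fact
  note [measurable_cong] = sets
  define d where "d j = dist (z k) (z j)" for j
  define L where "L = ln (1 / q)"
  \<comment> \<open>upper bounds for the potential of the measure at the earlier points\<close>
  define b where "b j = (if d j < 2 * R then ln (D / R) + 2 * L else ln (D / d j) + 2 * R / d j)" for j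
  have zK: "z j \<in> K" for j
    using leja by (simp add: leja_sequence_def)
  have d: "0 < d j" "d j \<le> D" if "j < k" for j
    using distinct[OF that] diam[OF zK zK] by (auto simp: d_def)
  have "0 \<le> L"
    using q by (simp add: L_def)
  have "0 < D" using R by linarith
  have b_nonneg: "0 \<le> b j" if "j < k" for j
    using d[OF that] R \<open>0 \<le> L\<close> by (auto simp: b_def)
  have AE_K: "AE x in \<mu>. x \<in> K"
    using \<mu>K by (intro AE_prob_1) (simp add: measure_def)
  have "ennreal (\<Sum>j<k. ln (D / d j)) = (\<integral>\<^sup>+ x. ennreal (\<Sum>j<k. ln (D / d j)) \<partial>\<mu>)"
    by (simp add: emeasure_space_1)
  also have "\<dots> \<le> (\<integral>\<^sup>+ x. (\<Sum>j<k. scaled_log_kernel D (z j) x) \<partial>\<mu>)"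
    by (rule nn_integral_mono_AE, use AE_K in eventually_elim)
      (use leja_sum_le_potential[OF leja diam \<open>0 < D\<close> _ distinct] in \<open>auto simp: d_def\<close>)
  also have "\<dots> = (\<Sum>j<k. \<integral>\<^sup>+ x. scaled_log_kernel D (z j) x \<partial>\<mu>)"
    by (rule nn_integral_sum) measurable
  also have "\<dots> \<le> (\<Sum>j<k. ennreal (b j))"
  proof (rule sum_mono)
    fix j
    show "(\<integral>\<^sup>+ x. scaled_log_kernel D (z j) x \<partial>\<mu>) \<le> ennreal (b j)"
    proof (cases "d j < 2 * R")
      case True
      then show ?thesis
        using log_potential_le[OF prob sets R q \<mu>(3)] by (simp add: b_def L_def)
    next
      case False
      then show ?thesis
        using log_potential_far_le[OF prob sets \<mu>(2) \<open>0 < D\<close> R(1), of "z j"]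
        by (simp add: b_def d_def)
    qed
  qed
  also have "\<dots> = ennreal (\<Sum>j<k. b j)"
    using b_nonneg by (intro sum_ennreal) auto
  finally have opt: "(\<Sum>j<k. ln (D / d j)) \<le> (\<Sum>j<k. b j)"
    using b_nonneg by (subst (asm) ennreal_le_iff) (auto intro!: sum_nonneg)
  have "ln (1 + R / d j) + (b j - ln (D / d j))
      \<le> (8 + 8 * L) * (ln (1 + 2 * R / d j) - ln (1 + R / d j))" if "j < k" for j
  proof (cases "d j < 2 * R")
    case True
    have "b j - ln (D / d j) = 2 * L + ln (d j / R)"
      using True d(1)[OF that] R \<open>0 < D\<close> by (simp add: b_def ln_div)
    then show ?thesis
      using ln_doubling_near[OF d(1)[OF that] True \<open>0 \<le> L\<close>] by simp
  next
    case False
    then show ?thesis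
      using ln_doubling_far[OF R(1) _ \<open>0 \<le> L\<close>, of "d j"] by (simp add: b_def)
  qed
  then have "(\<Sum>j<k. ln (1 + R / d j) + (b j - ln (D / d j)))
      \<le> (\<Sum>j<k. (8 + 8 * L) * (ln (1 + 2 * R / d j) - ln (1 + R / d j)))"
    by (intro sum_mono) auto
  then have "G R + ((\<Sum>j<k. b j) - (\<Sum>j<k. ln (D / d j))) \<le> (8 + 8 * L) * (G (2 * R) - G R)"
    by (simp only: G_def d_def[symmetric] sum.distrib sum_subtractf sum_distrib_left[symmetric])
  with opt show ?thesis
    by (simp add: L_def)
qed

text \<open>
  Each halving of \<open>R\<close> divides \<open>G R\<close> by at least \<open>1 + 1 / A\<close>, starting from at most \<open>A * k\<close>. After about
  \<open>log (1 + 1 / A) (2 * A * k)\<close> halvings \<open>G\<close> is at most \<open>1/2 < ln 2\<close>, and a single term \<open>ln (1 + R / d) < ln 2\<close>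
  forces \<open>R < d\<close>.
\<close>

lemma geometric_decay_gives_power_separation:
  fixes G :: "real \<Rightarrow> real"
  assumes "1 \<le> A" "0 < \<Delta>" "1 \<le> k" and doubling: "\<And>R. 0 < R \<Longrightarrow> R \<le> \<Delta> \<Longrightarrow> G R \<le> A * (G (2 * R) - G R)"
    and top: "G (2 * \<Delta>) - G \<Delta> \<le> real k"
    and "0 < d" and lower: "\<And>R. 0 < R \<Longrightarrow> ln (1 + R / d) \<le> G R"
  defines "a \<equiv> log (1 + 1 / A) 2"
  shows "\<Delta> / (2 * (2 * A) powr a) * real k powr (- a) \<le> d"
proof -
  define b where "b = 1 + 1 / A"
  have b: "1 < b" using assms(1) by (simp add: b_def)
  have step: "b * G R \<le> G (2 * R)" if "0 < R" "R \<le> \<Delta>" for R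
    using doubling[OF that] assms(1) by (simp add: b_def field_simps)
  have decay: "b ^ m * G (\<Delta> / 2 ^ m) \<le> A * real k" for m
  proof (induction m)
    case 0
    have "G \<Delta> \<le> A * (G (2 * \<Delta>) - G \<Delta>)"
      using assms(2) by (intro doubling) auto
    also have "\<dots> \<le> A * real k"
      using top assms(1) by (intro mult_left_mono) auto
    finally show ?case by simp
  next
    case (Suc m)
    have "b * G (\<Delta> / 2 ^ Suc m) \<le> G (2 * (\<Delta> / 2 ^ Suc m))"
      using assms(2) one_le_power[of "2::real" "Suc m"]
      by (intro step) (simp_all add: divide_le_eq mult_le_cancel_left1 del: power_Suc)
    then have "b ^ m * (b * G (\<Delta> / 2 ^ Suc m)) \<le> b ^ m * G (\<Delta> / 2 ^ m)"
      using b by (intro mult_left_mono) auto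
    with Suc.IH show ?case
      by (simp add: mult_ac)
  qed
  define x where "x = 2 * A * real k"
  have "1 \<le> A * real k"
    using assms(1,3) mult_mono[of 1 A 1 "real k"] by simp
  then have x: "1 < x"
    by (simp add: x_def)
  \<comment> \<open>the least number of halvings with \<open>b ^ m \<ge> 2 * A * k\<close>\<close>
  define m where "m = nat \<lceil>log b x\<rceil>"
  have "0 < log b x"
    using b x by simp
  then have m: "log b x \<le> real m" "real m \<le> log b x + 1"
    unfolding m_def by linarith+
  have "x = b powr (log b x)"
    using b x by simp
  also have "\<dots> \<le> b powr (real m)"
    using b m(1) by simp
  also have "\<dots> = b ^ m"
    using b by (simp add: powr_realpow)
  finally have "x \<le> b ^ m" .
  have far: "\<Delta> / 2 ^ m \<le> d"
  proof (rule ccontr)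
    assume "\<not> ?thesis"
    then have "1 < \<Delta> / 2 ^ m / d"
      using assms(6) by (simp add: field_simps)
    then have "ln 2 < ln (1 + \<Delta> / 2 ^ m / d)"
      by (intro ln_less_cancel_iff[THEN iffD2]) auto
    also have "\<dots> \<le> G (\<Delta> / 2 ^ m)"
      using assms(2) by (intro lower) simp
    finally have "1 / 2 < G (\<Delta> / 2 ^ m)"
      using ln2_ge_two_thirds by linarith
    then have "x * (1 / 2) < b ^ m * G (\<Delta> / 2 ^ m)"
      using \<open>x \<le> b ^ m\<close> x by (intro mult_le_less_imp_less) auto
    with decay[of m] show False
      by (simp add: x_def)
  qed
  have "(2::real) ^ m = 2 powr real m"
    by (simp add: powr_realpow)
  also have "\<dots> \<le> 2 powr (log b x + 1)"
    using m(2) by simp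
  also have "\<dots> = 2 * 2 powr log b x"
    by (simp add: powr_add)
  also have "2 powr log b x = x powr a"
    using b x by (simp add: powr_def log_def a_def b_def[symmetric] mult.commute)
  also have "x powr a = (2 * A) powr a * real k powr a"
    using assms(1) by (simp add: x_def powr_mult)
  finally have "\<Delta> / (2 * ((2 * A) powr a * real k powr a)) \<le> \<Delta> / 2 ^ m"
    using assms(2,3) by (intro divide_left_mono) (use assms(1) in auto)
  moreover have "\<Delta> / (2 * (2 * A) powr a) * real k powr (- a) = \<Delta> / (2 * ((2 * A) powr a * real k powr a))"
    by (simp only: powr_minus divide_inverse inverse_mult_distrib mult_ac)
  ultimately show ?thesis
    using far by linarith
qed

section \<open>Energy of smeared points and capacity\<close>

text \<open>
  For \<open>D \<ge> 1\<close> both truncations in the energy are compatible with the shift by \<open>ln D\<close>, and the integral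
  of the negative part is at most \<open>ln D\<close>, so the difference is never \<open>\<infinity> - \<infinity>\<close>.
\<close>

lemma log_energy_eq_scaled:
  assumes "K \<in> sets borel" and \<mu>: "\<mu> \<in> prob_measures_on K"
    and "1 \<le> D" and diam: "\<And>x y. x \<in> K \<Longrightarrow> y \<in> K \<Longrightarrow> dist x y \<le> D"
  shows "log_energy \<mu> =
    enn2ereal (\<integral>\<^sup>+ (z, w). scaled_log_kernel D z w \<partial>(\<mu> \<Otimes>\<^sub>M \<mu>)) - ereal (ln D)"
proof -
  have sets: "sets \<mu> = sets borel" and prob: "prob_space \<mu>" and \<mu>K: "emeasure \<mu> K = 1"
    using \<mu> by (auto simp: prob_measures_on_def)
  interpret prob_space \<mu> by fact
  interpret pair: pair_prob_space \<mu> \<mu> ..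
  note [measurable_cong] = sets
  note [measurable] = \<open>K \<in> sets borel\<close>
  have [measurable]: "(\<lambda>p. log_kernel (fst p) (snd p)) \<in> borel_measurable (\<mu> \<Otimes>\<^sub>M \<mu>)"
    unfolding log_kernel_def by measurable
  define P where "P = (\<integral>\<^sup>+ (z, w). e2ennreal (log_kernel z w) \<partial>(\<mu> \<Otimes>\<^sub>M \<mu>))"
  define N where "N = (\<integral>\<^sup>+ (z, w). e2ennreal (- log_kernel z w) \<partial>(\<mu> \<Otimes>\<^sub>M \<mu>))"
  define E where "E = (\<integral>\<^sup>+ (z, w). scaled_log_kernel D z w \<partial>(\<mu> \<Otimes>\<^sub>M \<mu>))"
  have "0 \<le> ln D"
    using assms(3) by simp
  have AE_K: "AE x in \<mu>. x \<in> K"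
    using \<mu>K by (intro AE_prob_1) (simp add: measure_def)
  have AE_pair: "AE p in \<mu> \<Otimes>\<^sub>M \<mu>. fst p \<in> K \<and> snd p \<in> K"
  proof (rule pair.AE_pair_measure)
    show "{p \<in> space (\<mu> \<Otimes>\<^sub>M \<mu>). fst p \<in> K \<and> snd p \<in> K} \<in> sets (\<mu> \<Otimes>\<^sub>M \<mu>)"
      by measurable
    show "AE x in \<mu>. AE y in \<mu>. fst (x, y) \<in> K \<and> snd (x, y) \<in> K"
      using AE_K by eventually_elim (use AE_K in simp)
  qed
  have split: "e2ennreal (log_kernel x y) + ennreal (ln D) = e2ennreal (- log_kernel x y) + scaled_log_kernel D x y"
    and neg: "e2ennreal (- log_kernel x y) \<le> ennreal (ln D)" if "x \<in> K" "y \<in> K" for x y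
  proof -
    have "e2ennreal (log_kernel x y) + ennreal (ln D) = e2ennreal (- log_kernel x y) + scaled_log_kernel D x y
      \<and> e2ennreal (- log_kernel x y) \<le> ennreal (ln D)"
    proof (cases "x = y")
      case True
      then show ?thesis
        by (simp add: log_kernel_def scaled_log_kernel_def e2ennreal_neg)
    next
      case False
      define l where "l = ln (dist x y)"
      have "l \<le> ln D"
        using False diam[OF that] assms(3) by (simp add: l_def)
      moreover have "log_kernel x y = ereal (- l)" "scaled_log_kernel D x y = ennreal (ln D - l)"
        using False assms(3) by (simp_all add: log_kernel_def scaled_log_kernel_def l_def ln_div)
      ultimately show ?thesis
        using \<open>0 \<le> ln D\<close>
        by (cases "0 \<le> l") (auto simp: e2ennreal_ereal ennreal_plus[symmetric] ennreal_neg
            simp del: ennreal_plus intro!: ennreal_leI)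
    qed
    then show "e2ennreal (log_kernel x y) + ennreal (ln D) = e2ennreal (- log_kernel x y) + scaled_log_kernel D x y"
      and "e2ennreal (- log_kernel x y) \<le> ennreal (ln D)" by blast+
  qed
  have "P + ennreal (ln D) = (\<integral>\<^sup>+ (z, w). e2ennreal (log_kernel z w) + ennreal (ln D) \<partial>(\<mu> \<Otimes>\<^sub>M \<mu>))"
    unfolding P_def split_beta by (subst nn_integral_add) (auto simp: pair.emeasure_space_1)
  also have "\<dots> = (\<integral>\<^sup>+ (z, w). e2ennreal (- log_kernel z w) + scaled_log_kernel D z w \<partial>(\<mu> \<Otimes>\<^sub>M \<mu>))"
    by (rule nn_integral_cong_AE, use AE_pair in eventually_elim) (simp add: split_beta split)
  also have "\<dots> = N + E"
    unfolding N_def E_def split_beta by (rule nn_integral_add) measurable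
  finally have "P + ennreal (ln D) = N + E" .
  moreover have "N \<le> (\<integral>\<^sup>+ p. ennreal (ln D) \<partial>(\<mu> \<Otimes>\<^sub>M \<mu>))"
    unfolding N_def
    by (rule nn_integral_mono_AE, use AE_pair in eventually_elim) (simp add: split_beta neg)
  then have "N \<le> ennreal (ln D)"
    by (simp add: pair.emeasure_space_1)
  then obtain n where "N = ennreal n" "0 \<le> n"
    by (cases N) (auto simp: top_unique)
  ultimately have "enn2ereal P - enn2ereal N = enn2ereal E - ereal (ln D)"
    using \<open>0 \<le> ln D\<close>
    by (cases P; cases E)
      (auto simp: enn2ereal_ennreal ennreal_plus[symmetric] ennreal_inj simp del: ennreal_plus)
  then show ?thesis
    by (simp add: log_energy_def P_def N_def E_def)
qed

text \<open>
  The scaled form of the energy bounds the Robin constant below by \<open>- ln D\<close>, and positive capacity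
  excludes the value \<open>\<infinity>\<close>. So it is a real number \<open>v\<close> with \<open>ln (log_cap K) = - v\<close>.
\<close>

lemma ln_log_cap_le_energy:
  assumes "compact K" "0 < log_cap K" and \<mu>: "\<mu> \<in> prob_measures_on K"
    and "1 \<le> D" and diam: "\<And>x y. x \<in> K \<Longrightarrow> y \<in> K \<Longrightarrow> dist x y \<le> D"
  shows "ennreal (ln D - ln (log_cap K)) \<le> (\<integral>\<^sup>+ (z, w). scaled_log_kernel D z w \<partial>(\<mu> \<Otimes>\<^sub>M \<mu>))"
    (is "_ \<le> ?E \<mu>")
proof -
  have K: "K \<in> sets borel"
    using assms(1) by (rule borel_compact)
  have energy: "log_energy \<nu> = enn2ereal (?E \<nu>) - ereal (ln D)" if "\<nu> \<in> prob_measures_on K" for \<nu>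
    using log_energy_eq_scaled[OF K that assms(4) diam] .
  have "robin_constant K \<noteq> \<infinity>"
    using assms(2) by (auto simp: log_cap_def)
  moreover have "- ereal (ln D) \<le> robin_constant K"
    unfolding robin_constant_def
  proof (rule INF_greatest)
    fix \<nu> assume \<nu>: "\<nu> \<in> prob_measures_on K"
    show "- ereal (ln D) \<le> log_energy \<nu>"
      unfolding energy[OF \<nu>] minus_ereal_def by (intro add_increasing) auto
  qed
  ultimately obtain v where v: "robin_constant K = ereal v"
    by (cases "robin_constant K") auto
  then have "ln (log_cap K) = - v"
    by (simp add: log_cap_def)
  moreover have "ereal v \<le> enn2ereal (?E \<mu>) - ereal (ln D)"
    using INF_lower[OF \<mu>, of log_energy] energy[OF \<mu>] v by (simp add: robin_constant_def)
  then have "ereal (v + ln D) \<le> enn2ereal (?E \<mu>)"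
    by (simp add: ereal_le_minus)
  then have "ennreal (v + ln D) \<le> ?E \<mu>"
    by (cases "?E \<mu>") (auto simp: enn2ereal_ennreal intro: ennreal_leI)
  ultimately show ?thesis
    by (simp add: add.commute)
qed

text \<open>
  The average is built as the law of a two-stage experiment: pick an index uniformly, then a point
  from the measure with this index.
\<close>

lemma average_measure_exists:
  assumes "0 < (N::nat)" "K \<in> sets borel" and M: "\<And>i. M i \<in> prob_measures_on K"
  shows "\<exists>\<mu>\<in>prob_measures_on K. \<forall>f\<in>borel_measurable borel.
           (\<integral>\<^sup>+ x. f x \<partial>\<mu>) = (\<Sum>i<N. \<integral>\<^sup>+ x. f x \<partial>M i) / of_nat N"
proof -
  define p where "p = measure_pmf (pmf_of_set {..<N})"
  define \<mu> where "\<mu> = p \<bind> M"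
  have M': "prob_space (M i)" "sets (M i) = sets borel" "emeasure (M i) K = 1" for i
    using M[of i] by (auto simp: prob_measures_on_def)
  have "M i \<in> space (prob_algebra borel)" for i
    using M'[of i] by (simp add: space_prob_algebra)
  then have Mp: "M \<in> p \<rightarrow>\<^sub>M prob_algebra borel"
    by (simp add: p_def)
  then have Ms: "M \<in> p \<rightarrow>\<^sub>M subprob_algebra borel"
    by (rule measurable_prob_algebraD)
  have sets: "sets \<mu> = sets borel"
    unfolding \<mu>_def using M'(2) by (intro sets_bind) (auto simp: p_def)
  have int: "(\<integral>\<^sup>+ x. f x \<partial>\<mu>) = (\<Sum>i<N. \<integral>\<^sup>+ x. f x \<partial>M i) / of_nat N" if "f \<in> borel_measurable borel" for f
  proof -
    have "(\<integral>\<^sup>+ x. f x \<partial>\<mu>) = (\<integral>\<^sup>+ i. \<integral>\<^sup>+ x. f x \<partial>M i \<partial>p)"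
      unfolding \<mu>_def using that Ms by (rule nn_integral_bind)
    also have "\<dots> = (\<Sum>i<N. \<integral>\<^sup>+ x. f x \<partial>M i) / of_nat N"
      using assms(1) unfolding p_def by (subst nn_integral_pmf_of_set) auto
    finally show ?thesis .
  qed
  have "prob_space \<mu>"
    unfolding \<mu>_def by (rule prob_space_bind'[OF _ Mp]) (simp add: p_def space_prob_algebra prob_space_measure_pmf)
  moreover have "emeasure \<mu> K = 1"
  proof -
    have "emeasure \<mu> K = (\<integral>\<^sup>+ x. indicator K x \<partial>\<mu>)"
      using assms(2) sets by simp
    also have "\<dots> = (\<Sum>i<N. \<integral>\<^sup>+ x. indicator K x \<partial>M i) / of_nat N"
      using assms(2) by (intro int) simp
    also have "\<dots> = of_nat N / of_nat N"
      using assms(2) M'(2,3) by simp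
    also have "\<dots> = 1"
      using assms(1) by (intro ennreal_divide_self) (auto simp: ennreal_of_nat_eq_real_of_nat)
    finally show ?thesis .
  qed
  ultimately show ?thesis
    using int sets by (intro bexI[of _ \<mu>]) (auto simp: prob_measures_on_def)
qed

lemma average_measure_energy:
  assumes "0 < N" and M: "\<And>i. sets (M i) = sets borel" "\<And>i. prob_space (M i)"
    and \<mu>: "prob_space \<mu>" "sets \<mu> = sets borel"
    and int: "\<forall>f\<in>borel_measurable borel. (\<integral>\<^sup>+ x. f x \<partial>\<mu>) = (\<Sum>i<N. \<integral>\<^sup>+ x. f x \<partial>M i) / of_nat N"
  shows "(\<integral>\<^sup>+ (z, w). scaled_log_kernel D z w \<partial>(\<mu> \<Otimes>\<^sub>M \<mu>)) =
    (\<Sum>i<N. \<Sum>j<N. \<integral>\<^sup>+ z. \<integral>\<^sup>+ w. scaled_log_kernel D z w \<partial>M j \<partial>M i) / of_nat N / of_nat N"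
proof -
  interpret prob_space \<mu> by fact
  note [measurable_cong] = \<mu>(2) M(1)
  have [measurable]: "(\<lambda>z. \<integral>\<^sup>+ w. scaled_log_kernel D z w \<partial>M j) \<in> borel_measurable borel" for j
  proof -
    interpret Mj: prob_space "M j" by (rule M)
    show ?thesis by measurable
  qed
  have "(\<integral>\<^sup>+ (z, w). scaled_log_kernel D z w \<partial>(\<mu> \<Otimes>\<^sub>M \<mu>)) = (\<integral>\<^sup>+ z. \<integral>\<^sup>+ w. scaled_log_kernel D z w \<partial>\<mu> \<partial>\<mu>)"
    by (subst nn_integral_fst[symmetric]) auto
  also have "\<dots> = (\<integral>\<^sup>+ z. (\<Sum>j<N. \<integral>\<^sup>+ w. scaled_log_kernel D z w \<partial>M j) / of_nat N \<partial>\<mu>)"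
    by (intro nn_integral_cong int[rule_format]) measurable
  also have "\<dots> = (\<Sum>i<N. \<integral>\<^sup>+ z. (\<Sum>j<N. \<integral>\<^sup>+ w. scaled_log_kernel D z w \<partial>M j) / of_nat N \<partial>M i) / of_nat N"
    by (intro int[rule_format]) measurable
  also have "\<dots> = (\<Sum>i<N. (\<Sum>j<N. \<integral>\<^sup>+ z. \<integral>\<^sup>+ w. scaled_log_kernel D z w \<partial>M j \<partial>M i) / of_nat N) / of_nat N"
    by (simp add: nn_integral_divide nn_integral_sum)
  also have "\<dots> = (\<Sum>i<N. \<Sum>j<N. \<integral>\<^sup>+ z. \<integral>\<^sup>+ w. scaled_log_kernel D z w \<partial>M j \<partial>M i) / of_nat N / of_nat N"
    by (simp add: divide_ennreal_def sum_distrib_right)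
  finally show ?thesis .
qed

lemma mutual_energy_far_le:
  assumes \<mu>: "prob_space \<mu>" "AE x in \<mu>. dist z x \<le> R" and \<nu>: "prob_space \<nu>" "AE y in \<nu>. dist w y \<le> R"
    and "0 < D" "0 < R" "4 * R \<le> dist z w"
  shows "(\<integral>\<^sup>+ x. \<integral>\<^sup>+ y. scaled_log_kernel D x y \<partial>\<nu> \<partial>\<mu>) \<le> ennreal (ln (D / dist z w) + 4 * R / dist z w)"
    (is "_ \<le> ?b")
proof -
  interpret \<mu>: prob_space \<mu> by fact
  interpret \<nu>: prob_space \<nu> by fact
  have "(\<integral>\<^sup>+ x. \<integral>\<^sup>+ y. scaled_log_kernel D x y \<partial>\<nu> \<partial>\<mu>) \<le> (\<integral>\<^sup>+ x. \<integral>\<^sup>+ y. ?b \<partial>\<nu> \<partial>\<mu>)"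
  proof (rule nn_integral_mono_AE, use \<mu>(2) in eventually_elim,
      rule nn_integral_mono_AE, use \<nu>(2) in eventually_elim)
    fix x y assume "dist z x \<le> R" "dist w y \<le> R"
    then have "dist z w - 2 * R \<le> dist x y"
      using dist_triangle[of z w x] dist_triangle[of x w y] by (simp add: dist_commute)
    moreover have "0 < dist z w"
      using assms(6,7) by linarith
    moreover have "x \<noteq> y"
      using \<open>dist z w - 2 * R \<le> dist x y\<close> assms(6,7) by auto
    ultimately show "scaled_log_kernel D x y \<le> ?b"
      using assms(5-7) ln_div_shift_le[of D "dist z w" "2 * R" "dist x y"]
      by (auto simp: scaled_log_kernel_def intro!: ennreal_leI)
  qed
  then show ?thesis
    by (simp add: \<mu>.emeasure_space_1 \<nu>.emeasure_space_1)
qed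

text \<open>
  The energy of the average of the measures \<open>M i\<close> is compared with the capacity. With \<open>R = \<sigma> / (4 * N)\<close> the
  displacement error of each pair is at most \<open>4 * R / \<sigma> = 1 / N\<close>, so the at most \<open>N\<^sup>2\<close> pairs together lose at
  most \<open>N\<close>; the \<open>N\<close> self-energies account for the remaining error.
\<close>

lemma ln_distances_le_capacity:
  assumes "compact K" "0 < log_cap K" "1 \<le> D" and diam: "\<And>x y. x \<in> K \<Longrightarrow> y \<in> K \<Longrightarrow> dist x y \<le> D"
    and N: "0 < N" and zK: "\<And>i. z i \<in> K"
    and \<sigma>: "0 < \<sigma>" "\<sigma> \<le> D" "\<And>i j. i < N \<Longrightarrow> j < N \<Longrightarrow> i \<noteq> j \<Longrightarrow> \<sigma> \<le> dist (z i) (z j)"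
    and R: "R = \<sigma> / (4 * real N)" and q: "0 < q" "q < 1"
    and M: "\<And>i. M i \<in> prob_measures_on K" "\<And>i. AE y in M i. dist (z i) y \<le> R"
      "\<And>i w m. emeasure (M i) (ball w (R * q ^ m)) \<le> ennreal ((1/2) ^ m)"
  shows "(\<Sum>i<N. \<Sum>j\<in>{..<N} - {i}. ln (dist (z i) (z j)))
    \<le> (real N)\<^sup>2 * ln (log_cap K) + real N * (1 + 2 * ln (1 / q) + ln (4 * real N / \<sigma>))"
proof -
  define L where "L = ln (1 / q)"
  have "0 \<le> L"
    using q by (simp add: L_def)
  have "0 < D" using assms(3) by linarith
  have "0 < R" "R \<le> D"
  proof -
    show "0 < R" using R \<sigma>(1) N by simp
    have "R \<le> \<sigma>"
      using \<sigma>(1) N unfolding R by (simp add: divide_le_eq mult_le_cancel_left1)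
    with \<sigma>(2) show "R \<le> D" by linarith
  qed
  have M': "prob_space (M i)" "sets (M i) = sets borel" for i
    using M(1)[of i] by (auto simp: prob_measures_on_def)
  define b where "b i j = (if i = j then ln (D / R) + 2 * L else ln (D / dist (z i) (z j)) + 1 / real N)" for i j
  have b_nonneg: "0 \<le> b i j" if "i < N" "j < N" for i j
  proof (cases "i = j")
    case True
    then show ?thesis
      using \<open>0 < R\<close> \<open>R \<le> D\<close> \<open>0 \<le> L\<close> by (simp add: b_def)
  next
    case False
    then have "0 < dist (z i) (z j)"
      using \<sigma>(1) \<sigma>(3)[OF that] by linarith
    then have "1 \<le> D / dist (z i) (z j)"
      using diam[OF zK zK, of i j] by (simp add: le_divide_eq)
    then show ?thesis
      using False by (simp add: b_def)
  qed
  have mutual: "(\<integral>\<^sup>+ x. \<integral>\<^sup>+ y. scaled_log_kernel D x y \<partial>M j \<partial>M i) \<le> ennreal (b i j)" if "i < N" "j < N" for i j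
  proof (cases "i = j")
    case True
    interpret prob_space "M i" by (rule M')
    have "(\<integral>\<^sup>+ x. \<integral>\<^sup>+ y. scaled_log_kernel D x y \<partial>M i \<partial>M i) \<le> (\<integral>\<^sup>+ x. ennreal (b i i) \<partial>M i)"
      using log_potential_le[OF M'(1,2) \<open>0 < R\<close> \<open>R \<le> D\<close> q M(3)]
      by (intro nn_integral_mono) (simp add: b_def L_def)
    also have "\<dots> = ennreal (b i i)"
      by (simp add: emeasure_space_1)
    finally show ?thesis
      using True by simp
  next
    case False
    define d where "d = dist (z i) (z j)"
    have "\<sigma> \<le> d"
      using \<sigma>(3)[OF that False] by (simp add: d_def)
    have "4 * R = \<sigma> / real N"
      by (simp add: R)
    also have "\<dots> \<le> d / real N"
      using \<open>\<sigma> \<le> d\<close> by (intro divide_right_mono) auto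
    finally have small: "4 * R \<le> d / real N" .
    also have "\<dots> \<le> d"
      using N \<sigma>(1) \<open>\<sigma> \<le> d\<close> by (simp add: divide_le_eq mult_le_cancel_left1)
    finally have "4 * R \<le> d" .
    then have "(\<integral>\<^sup>+ x. \<integral>\<^sup>+ y. scaled_log_kernel D x y \<partial>M j \<partial>M i) \<le> ennreal (ln (D / d) + 4 * R / d)"
      unfolding d_def
      by (intro mutual_energy_far_le M' M(2) \<open>0 < D\<close> \<open>0 < R\<close>)
    also have "\<dots> \<le> ennreal (b i j)"
    proof (rule ennreal_leI)
      have "4 * R / d \<le> 1 / real N"
        using small \<sigma>(1) \<open>\<sigma> \<le> d\<close> N by (simp add: field_simps)
      then show "ln (D / d) + 4 * R / d \<le> b i j"
        using False by (simp add: b_def d_def)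
    qed
    finally show ?thesis .
  qed
  have "K \<in> sets borel"
    using assms(1) by (rule borel_compact)
  from average_measure_exists[OF N this, of M] M(1) obtain \<mu> where \<mu>: "\<mu> \<in> prob_measures_on K"
    and int: "\<forall>f\<in>borel_measurable borel. (\<integral>\<^sup>+ x. f x \<partial>\<mu>) = (\<Sum>i<N. \<integral>\<^sup>+ x. f x \<partial>M i) / of_nat N"
    by blast
  have \<mu>': "prob_space \<mu>" "sets \<mu> = sets borel"
    using \<mu> by (auto simp: prob_measures_on_def)
  have "ennreal (ln D - ln (log_cap K)) \<le> (\<integral>\<^sup>+ (z, w). scaled_log_kernel D z w \<partial>(\<mu> \<Otimes>\<^sub>M \<mu>))"
    by (rule ln_log_cap_le_energy[OF assms(1,2) \<mu> assms(3) diam])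
  also have "\<dots> = (\<Sum>i<N. \<Sum>j<N. \<integral>\<^sup>+ z. \<integral>\<^sup>+ w. scaled_log_kernel D z w \<partial>M j \<partial>M i) / of_nat N / of_nat N"
    by (rule average_measure_energy[OF N M'(2,1) \<mu>' int])
  also have "\<dots> \<le> (\<Sum>i<N. \<Sum>j<N. ennreal (b i j)) / of_nat N / of_nat N"
    by (intro divide_right_mono_ennreal sum_mono mutual) auto
  also have "(\<Sum>i<N. \<Sum>j<N. ennreal (b i j)) = ennreal (\<Sum>i<N. \<Sum>j<N. b i j)"
    using b_nonneg by (subst sum_ennreal[symmetric]) (auto intro!: sum.cong sum_nonneg sum_ennreal)
  also have "\<dots> / of_nat N / of_nat N = ennreal ((\<Sum>i<N. \<Sum>j<N. b i j) / real N / real N)"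
  proof -
    have "0 \<le> (\<Sum>i<N. \<Sum>j<N. b i j)"
      using b_nonneg by (intro sum_nonneg) auto
    then show ?thesis
      using N by (simp add: ennreal_of_nat_eq_real_of_nat divide_ennreal)
  qed
  finally have "ln D - ln (log_cap K) \<le> (\<Sum>i<N. \<Sum>j<N. b i j) / real N / real N"
    using b_nonneg by (subst (asm) ennreal_le_iff) (auto intro!: sum_nonneg divide_nonneg_nonneg)
  then have "(real N)\<^sup>2 * (ln D - ln (log_cap K)) \<le> (\<Sum>i<N. \<Sum>j<N. b i j)"
    using N by (simp add: field_simps power2_eq_square)
  also have "\<dots> = (\<Sum>i<N. (ln (D / R) + 2 * L) + (real N - 1) * (ln D + 1 / real N)
      - (\<Sum>j\<in>{..<N} - {i}. ln (dist (z i) (z j))))"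
  proof (rule sum.cong[OF refl])
    fix i assume i: "i \<in> {..<N}"
    have "(\<Sum>j\<in>{..<N} - {i}. b i j) = (\<Sum>j\<in>{..<N} - {i}. (ln D + 1 / real N) - ln (dist (z i) (z j)))"
    proof (rule sum.cong[OF refl])
      fix j assume "j \<in> {..<N} - {i}"
      then show "b i j = (ln D + 1 / real N) - ln (dist (z i) (z j))"
        using \<sigma>(1) \<sigma>(3)[of i j] i \<open>0 < D\<close> by (auto simp: b_def ln_div)
    qed
    also have "\<dots> = (real N - 1) * (ln D + 1 / real N) - (\<Sum>j\<in>{..<N} - {i}. ln (dist (z i) (z j)))"
      using i N by (simp add: sum_subtractf of_nat_diff)
    finally show "(\<Sum>j<N. b i j) = (ln (D / R) + 2 * L) + (real N - 1) * (ln D + 1 / real N)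
        - (\<Sum>j\<in>{..<N} - {i}. ln (dist (z i) (z j)))"
      using i by (subst sum.remove[of _ i]) (auto simp: b_def)
  qed
  also have "\<dots> = real N * ((ln (D / R) + 2 * L) + (real N - 1) * (ln D + 1 / real N))
      - (\<Sum>i<N. \<Sum>j\<in>{..<N} - {i}. ln (dist (z i) (z j)))"
    by (simp add: sum_subtractf)
  also have "real N * ((ln (D / R) + 2 * L) + (real N - 1) * (ln D + 1 / real N))
      = (real N)\<^sup>2 * ln D + real N * (2 * L - ln R) + (real N - 1)"
    using N \<open>0 < D\<close> \<open>0 < R\<close> by (simp add: ln_div field_simps power2_eq_square)
  also have "- ln R = ln (4 * real N / \<sigma>)"
    using N \<sigma>(1) by (simp add: R ln_div)
  then have "2 * L - ln R = 2 * L + ln (4 * real N / \<sigma>)"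
    by simp
  finally show ?thesis
    using N by (simp add: L_def algebra_simps)
qed

section \<open>Consequences of uniform perfectness and positive capacity\<close>

text \<open>
  The form in which uniform perfectness enters the estimates: around each point and at each scale there
  is a measure on \<open>K\<close> whose mass on balls decays like a power of the radius, with uniform constants.
\<close>

definition carries_spread_measures :: "complex set \<Rightarrow> real \<Rightarrow> bool" where
  "carries_spread_measures K q \<longleftrightarrow> 0 < q \<and> q < 1 \<and>
     (\<forall>z\<in>K. \<forall>R. 0 < R \<and> R \<le> diameter K \<longrightarrow>
       (\<exists>\<mu>\<in>prob_measures_on K. (AE y in \<mu>. dist z y \<le> R) \<and>
          (\<forall>w m. emeasure \<mu> (ball w (R * q ^ m)) \<le> ennreal ((1/2) ^ m))))"

lemma uniformly_perfect_carries_spread_measures: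
  assumes "compact K" "uniformly_perfect K"
  shows "\<exists>q. carries_spread_measures K q"
proof -
  from assms(2) obtain \<gamma> where \<gamma>: "0 < \<gamma>" "\<gamma> < 1"
    and perf: "\<And>z r. z \<in> K \<Longrightarrow> 0 < r \<Longrightarrow> r < diameter K \<Longrightarrow>
        K \<inter> {\<zeta>. \<gamma> * r \<le> cmod (\<zeta> - z) \<and> cmod (\<zeta> - z) \<le> r} \<noteq> {}"
    unfolding uniformly_perfect_def by blast
  have perfect: "\<exists>y\<in>K. \<gamma> * r \<le> dist y x \<and> dist y x \<le> r" if "x \<in> K" "0 < r" "r < diameter K" for x r
    using perf[OF that] by (auto simp: dist_norm)
  have "\<exists>\<mu>\<in>prob_measures_on K. (AE y in \<mu>. dist z y \<le> R) \<and>
      (\<forall>w m. emeasure \<mu> (ball w (R * (\<gamma> / 8) ^ m)) \<le> ennreal ((1/2) ^ m))"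
    if z: "z \<in> K" and R: "0 < R" "R \<le> diameter K" for z R
  proof -
    obtain \<mu> where \<mu>: "\<mu> \<in> prob_measures_on K" "emeasure \<mu> (K \<inter> cball z R) = 1"
      "\<forall>w m. emeasure \<mu> (ball w (R * (\<gamma> / 8) ^ m)) \<le> ennreal ((1/2) ^ m)"
      using cantor_measure_exists[OF assms(1) \<gamma> z R perfect] by blast
    interpret prob_space \<mu>
      using \<mu>(1) by (simp add: prob_measures_on_def)
    have "AE y in \<mu>. y \<in> K \<inter> cball z R"
      using \<mu>(2) by (intro AE_prob_1) (simp add: measure_def)
    then have "AE y in \<mu>. dist z y \<le> R"
      by eventually_elim simp
    with \<mu> show ?thesis by blast
  qed
  then show ?thesis
    using \<gamma> by (intro exI[of _ "\<gamma> / 8"]) (simp add: carries_spread_measures_def)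
qed

text \<open>
  Every probability measure on a single point has infinite energy. The case has to be
  excluded because a single point satisfies the condition of uniform perfectness vacuously.
\<close>

lemma log_cap_pos_imp_two_points:
  assumes "compact K" "0 < log_cap K"
  obtains x y where "x \<in> K" "y \<in> K" "x \<noteq> y"
proof (rule ccontr)
  assume "\<not> thesis"
  then have "\<And>x y. x \<in> K \<Longrightarrow> y \<in> K \<Longrightarrow> x = y"
    using that by blast
  then obtain a where a: "K \<subseteq> {a}"
    by blast
  have "log_energy \<mu> = \<infinity>" if \<mu>: "\<mu> \<in> prob_measures_on K" for \<mu>
  proof -
    have sets: "sets \<mu> = sets borel" and \<mu>K: "emeasure \<mu> K = 1"
      using \<mu> by (auto simp: prob_measures_on_def)
    interpret prob_space \<mu>
      using \<mu> by (simp add: prob_measures_on_def)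
    note [measurable_cong] = sets
    have "AE x in \<mu>. x \<in> K"
      using \<mu>K by (intro AE_prob_1) (simp add: measure_def)
    then have AE_a: "AE x in \<mu>. x = a"
      by eventually_elim (use a in blast)
    have "(\<integral>\<^sup>+ (z, w). scaled_log_kernel 1 z w \<partial>(\<mu> \<Otimes>\<^sub>M \<mu>)) = (\<integral>\<^sup>+ z. \<integral>\<^sup>+ w. scaled_log_kernel 1 z w \<partial>\<mu> \<partial>\<mu>)"
      by (subst nn_integral_fst[symmetric]) auto
    also have "\<dots> = (\<integral>\<^sup>+ z. \<integral>\<^sup>+ w. \<infinity> \<partial>\<mu> \<partial>\<mu>)"
    proof (rule nn_integral_cong_AE, use AE_a in eventually_elim,
        rule nn_integral_cong_AE, use AE_a in eventually_elim)
      fix z w assume "z = a" "w = a"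
      then show "scaled_log_kernel 1 z w = \<infinity>"
        by (simp add: scaled_log_kernel_def)
    qed
    also have "\<dots> = \<infinity>"
      by (simp add: emeasure_space_1)
    finally have "(\<integral>\<^sup>+ (z, w). scaled_log_kernel 1 z w \<partial>(\<mu> \<Otimes>\<^sub>M \<mu>)) = \<infinity>" .
    moreover have "dist x y \<le> 1" if "x \<in> K" "y \<in> K" for x y
    proof -
      have "x = y" using that a by blast
      then show ?thesis by simp
    qed
    then have "log_energy \<mu> =
        enn2ereal (\<integral>\<^sup>+ (z, w). scaled_log_kernel 1 z w \<partial>(\<mu> \<Otimes>\<^sub>M \<mu>)) - ereal (ln 1)"
      by (intro log_energy_eq_scaled[OF borel_compact[OF assms(1)] \<mu>]) auto
    ultimately show ?thesis
      by simp
  qed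
  then have "robin_constant K = \<infinity>"
    unfolding robin_constant_def by (simp add: top_ereal_def[symmetric])
  with assms(2) show False
    by (simp add: log_cap_def)
qed

lemma uniformly_perfect_infinite:
  assumes "uniformly_perfect K" "z \<in> K" "0 < diameter K"
  shows "infinite K"
proof -
  from assms(1) obtain \<gamma> where \<gamma>: "0 < \<gamma>"
    and perf: "\<And>z r. z \<in> K \<Longrightarrow> 0 < r \<Longrightarrow> r < diameter K \<Longrightarrow>
        K \<inter> {\<zeta>. \<gamma> * r \<le> cmod (\<zeta> - z) \<and> cmod (\<zeta> - z) \<le> r} \<noteq> {}"
    unfolding uniformly_perfect_def by blast
  have "z islimpt K"
    unfolding islimpt_approachable
  proof (intro allI impI)
    fix e :: real assume "0 < e"
    \<comment> \<open>half of the minimum, because the condition asks for \<open>r < diameter K\<close> strictly\<close>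
    define r where "r = min e (diameter K) / 2"
    have r: "0 < r" "r < e" "r < diameter K"
      using \<open>0 < e\<close> assms(3) by (auto simp: r_def)
    from perf[OF assms(2) r(1,3)] obtain y where "y \<in> K" "\<gamma> * r \<le> dist y z" "dist y z \<le> r"
      by (auto simp: dist_norm)
    moreover have "0 < \<gamma> * r"
      using \<gamma> r(1) by simp
    ultimately show "\<exists>y\<in>K. y \<noteq> z \<and> dist y z < e"
      using r(2) by (intro bexI[of _ y]) auto
  qed
  then show ?thesis
    using islimpt_finite by blast
qed

lemma leja_separation:
  assumes "compact K" "infinite K" "0 < diameter K" and spread: "carries_spread_measures K q"
    and leja: "leja_sequence K z"
  shows "\<exists>a>0. \<exists>s>0. s \<le> diameter K \<and> (\<forall>k. \<forall>j<k. s * real k powr (- a) \<le> dist (z k) (z j))"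
proof -
  define \<Delta> where "\<Delta> = diameter K"
  define A where "A = 8 + 8 * ln (1 / q)"
  define a where "a = log (1 + 1 / A) 2"
  define s where "s = \<Delta> / (2 * (2 * A) powr a)"
  have q: "0 < q" "q < 1"
    using spread by (auto simp: carries_spread_measures_def)
  then have "8 \<le> A"
    by (simp add: A_def)
  then have "0 < a"
    by (simp add: a_def)
  have "0 < \<Delta>" using assms(3) by (simp add: \<Delta>_def)
  have zK: "z j \<in> K" for j
    using leja by (simp add: leja_sequence_def)
  have diam: "dist x y \<le> \<Delta>" if "x \<in> K" "y \<in> K" for x y
    unfolding \<Delta>_def using diameter_bounded_bound[OF compact_imp_bounded[OF assms(1)] that] .
  have inj: "z j \<noteq> z k" if "j < k" for j k
    using leja_sequence_inj[OF assms(1,2) leja] that by (auto dest: injD)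
  have "s * real k powr (- a) \<le> dist (z k) (z j)" if "j < k" for j k
  proof -
    define G where "G \<rho> = (\<Sum>i<k. ln (1 + \<rho> / dist (z k) (z i)))" for \<rho>
    have pos: "0 < dist (z k) (z i)" if "i < k" for i
      using inj[OF that] by simp
    have doubling: "G R \<le> A * (G (2 * R) - G R)" if R: "0 < R" "R \<le> \<Delta>" for R
    proof -
      obtain \<mu> where "\<mu> \<in> prob_measures_on K" "AE y in \<mu>. dist (z k) y \<le> R"
        "\<And>w m. emeasure \<mu> (ball w (R * q ^ m)) \<le> ennreal ((1/2) ^ m)"
        using spread zK[of k] R unfolding carries_spread_measures_def \<Delta>_def by blast
      from leja_doubling[OF leja diam inj R q this] show ?thesis
        unfolding G_def A_def by simp
    qed
    have top: "G (2 * \<Delta>) - G \<Delta> \<le> real k"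
    proof -
      have "ln (1 + 2 * \<Delta> / dist (z k) (z i)) - ln (1 + \<Delta> / dist (z k) (z i)) \<le> 1" if "i < k" for i
      proof -
        define u where "u = \<Delta> / dist (z k) (z i)"
        have "0 < u"
          using \<open>0 < \<Delta>\<close> pos[OF that] by (simp add: u_def)
        then have "ln (1 + 2 * u) \<le> ln (2 * (1 + u))"
          by (intro ln_mono) auto
        also have "\<dots> = ln 2 + ln (1 + u)"
          using \<open>0 < u\<close> by (intro ln_mult_pos) auto
        finally have "ln (1 + 2 * u) - ln (1 + u) \<le> 1"
          using ln_2_less_1 by linarith
        then show ?thesis
          by (simp add: u_def)
      qed
      then have "(\<Sum>i<k. ln (1 + 2 * \<Delta> / dist (z k) (z i)) - ln (1 + \<Delta> / dist (z k) (z i))) \<le> (\<Sum>i<k. 1)"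
        by (intro sum_mono) auto
      then show ?thesis
        by (simp add: G_def sum_subtractf)
    qed
    have lower: "ln (1 + R / dist (z k) (z j)) \<le> G R" if "0 < R" for R
      unfolding G_def using \<open>j < k\<close> that pos by (intro member_le_sum) (auto intro!: ln_ge_zero)
    have "1 \<le> A" "1 \<le> k"
      using \<open>8 \<le> A\<close> \<open>j < k\<close> by linarith+
    from geometric_decay_gives_power_separation[OF this(1) \<open>0 < \<Delta>\<close> this(2) doubling top pos[OF \<open>j < k\<close>] lower]
    show ?thesis
      by (simp add: s_def a_def)
  qed
  moreover have "1 \<le> (2 * A) powr a"
    using \<open>8 \<le> A\<close> \<open>0 < a\<close> by (intro ge_one_powr_ge_zero) auto
  then have one_le: "1 \<le> 2 * (2 * A) powr a"
    by linarith
  then have "0 < s"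
    using \<open>0 < \<Delta>\<close> unfolding s_def by (intro divide_pos_pos) linarith+
  moreover have "s \<le> \<Delta>"
    using divide_left_mono[OF one_le, of \<Delta>] \<open>0 < \<Delta>\<close> \<open>8 \<le> A\<close> by (simp add: s_def)
  ultimately show ?thesis
    using \<open>0 < a\<close> unfolding \<Delta>_def by blast
qed

section \<open>Averages of Chebyshev norms\<close>

lemma sum_off_diagonal_symmetric:
  fixes f :: "nat \<Rightarrow> nat \<Rightarrow> real"
  assumes "\<And>i j. f i j = f j i"
  shows "(\<Sum>i<N. \<Sum>j\<in>{..<N} - {i}. f i j) = 2 * (\<Sum>k<N. \<Sum>j<k. f k j)"
proof (induction N)
  case (Suc N)
  have "(\<Sum>j\<in>{..<Suc N} - {i}. f i j) = f N i + (\<Sum>j\<in>{..<N} - {i}. f i j)" if "i < N" for i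
  proof -
    have "{..<Suc N} - {i} = insert N ({..<N} - {i})"
      using that by auto
    then show ?thesis
      by (simp add: assms[of i N])
  qed
  then have "(\<Sum>i<N. \<Sum>j\<in>{..<Suc N} - {i}. f i j) = (\<Sum>j<N. f N j) + (\<Sum>i<N. \<Sum>j\<in>{..<N} - {i}. f i j)"
    by (simp add: sum.distrib)
  moreover have "{..<Suc N} - {N} = {..<N}"
    by auto
  ultimately show ?case
    using Suc.IH by simp
qed simp

text \<open>
  Adding the inequalities for all \<open>k\<close> counts each value \<open>a k\<close> twice on the right.
\<close>

lemma subadditive_le_twice_average:
  fixes a :: "nat \<Rightarrow> real"
  assumes "\<And>k. k \<le> n \<Longrightarrow> a n \<le> a k + a (n - k)"
  shows "real (Suc n) * a n \<le> 2 * (\<Sum>k<Suc n. a k)"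
proof -
  have "real (Suc n) * a n = (\<Sum>k<Suc n. a n)"
    by simp
  also have "\<dots> \<le> (\<Sum>k<Suc n. a k + a (Suc n - Suc k))"
    using assms by (intro sum_mono) auto
  also have "\<dots> = 2 * (\<Sum>k<Suc n. a k)"
    by (simp only: sum.distrib sum.nat_diff_reindex mult_2)
  finally show ?thesis .
qed

lemma sum_ln_distances_lower_bound:
  assumes "compact K" "infinite K" "leja_sequence K z" "0 < k"
  shows "ln (sup_norm_on K (chebyshev_poly K k)) \<le> (\<Sum>j<k. ln (dist (z k) (z j)))"
proof -
  define P where "P = (\<Prod>j<k. [:- z j, 1:])"
  have "degree P = k"
    unfolding P_def by (subst degree_prod_eq_sum_degree) auto
  moreover have "lead_coeff P = 1"
    unfolding P_def lead_coeff_prod by simp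
  ultimately have "sup_norm_on K (chebyshev_poly K k) \<le> sup_norm_on K P"
    by (rule chebyshev_poly_minimal(3)[OF assms(1,2,4)])
  also have "\<dots> \<le> (\<Prod>j<k. dist (z k) (z j))"
    unfolding P_def by (rule sup_norm_on_prod_le_leja) fact
  finally have le: "sup_norm_on K (chebyshev_poly K k) \<le> (\<Prod>j<k. dist (z k) (z j))" .
  have "chebyshev_poly K k \<noteq> 0"
    using chebyshev_poly_minimal(1)[OF assms(1,2,4)] assms(4) by auto
  then have "0 < sup_norm_on K (chebyshev_poly K k)"
    by (intro sup_norm_on_pos assms)
  with le have "ln (sup_norm_on K (chebyshev_poly K k)) \<le> ln (\<Prod>j<k. dist (z k) (z j))"
    by simp
  also have "\<dots> = (\<Sum>j<k. ln (dist (z k) (z j)))"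
    using leja_sequence_inj[OF assms(1-3)] by (intro ln_prod) (auto dest: injD)
  finally show ?thesis .
qed

text \<open>
  By power separation, \<open>\<sigma> = s * N powr (- a)\<close> is a lower bound for the distances among the first \<open>N\<close> Leja
  points, and \<open>ln (4 * N / \<sigma>)\<close> grows like \<open>(1 + a) * ln N\<close>.
\<close>

lemma sum_ln_chebyshev_norms_le:
  assumes "compact K" "infinite K" "0 < diameter K" "0 < log_cap K"
    and spread: "carries_spread_measures K q"
  shows "\<exists>c>0. \<exists>C. \<forall>N>0. 2 * (\<Sum>k=1..<N. ln (sup_norm_on K (chebyshev_poly K k)))
    \<le> (real N)\<^sup>2 * ln (log_cap K) + real N * (C + c * ln (real N))"
proof -
  have "K \<noteq> {}" using assms(2) by auto
  have q: "0 < q" "q < 1"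
    using spread by (auto simp: carries_spread_measures_def)
  obtain z where leja: "leja_sequence K z"
    using leja_sequence_exists[OF assms(1) \<open>K \<noteq> {}\<close>] by blast
  have zK: "z j \<in> K" for j
    using leja by (simp add: leja_sequence_def)
  obtain a s where a: "0 < a" and s: "0 < s" "s \<le> diameter K"
    and sep: "\<And>k j. j < k \<Longrightarrow> s * real k powr (- a) \<le> dist (z k) (z j)"
    using leja_separation[OF assms(1-3) spread leja] by blast
  define D where "D = max 1 (diameter K)"
  have diam: "dist x y \<le> D" if "x \<in> K" "y \<in> K" for x y
    using diameter_bounded_bound[OF compact_imp_bounded[OF assms(1)] that] by (simp add: D_def)
  define C where "C = 1 + 2 * ln (1 / q) + ln (4 / s)"
  have "2 * (\<Sum>k=1..<N. ln (sup_norm_on K (chebyshev_poly K k)))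
      \<le> (real N)\<^sup>2 * ln (log_cap K) + real N * (C + (1 + a) * ln (real N))" if N: "0 < N" for N
  proof -
    define \<sigma> where "\<sigma> = s * real N powr (- a)"
    define R where "R = \<sigma> / (4 * real N)"
    have "real N powr (- a) \<le> 1"
      using N a powr_mono[of "- a" 0 "real N"] by simp
    then have \<sigma>: "0 < \<sigma>" "\<sigma> \<le> diameter K"
      using s N by (auto simp: \<sigma>_def intro: order_trans[OF mult_left_le])
    have R: "0 < R" "R \<le> diameter K"
    proof -
      show "0 < R" using \<sigma>(1) N by (simp add: R_def)
      have "R \<le> \<sigma>"
        using \<sigma>(1) N unfolding R_def by (simp add: divide_le_eq mult_le_cancel_left1)
      with \<sigma>(2) show "R \<le> diameter K" by linarith
    qed
    have \<sigma>_le: "\<sigma> \<le> dist (z k) (z j)" if "j < k" "k < N" for j k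
    proof -
      have "real N powr (- a) \<le> real k powr (- a)"
        using that a by (intro powr_mono2') auto
      then have "\<sigma> \<le> s * real k powr (- a)"
        using s(1) by (simp add: \<sigma>_def)
      also note sep[OF that(1)]
      finally show ?thesis .
    qed
    have \<sigma>_dist: "\<sigma> \<le> dist (z i) (z j)" if "i < N" "j < N" "i \<noteq> j" for i j
      using \<sigma>_le[of i j] \<sigma>_le[of j i] that by (cases "i < j") (auto simp: dist_commute)
    have "\<exists>\<mu>\<in>prob_measures_on K. (AE y in \<mu>. dist (z i) y \<le> R) \<and>
        (\<forall>w m. emeasure \<mu> (ball w (R * q ^ m)) \<le> ennreal ((1/2) ^ m))" for i
      using spread zK[of i] R unfolding carries_spread_measures_def by blast
    then obtain M where M: "\<And>i. M i \<in> prob_measures_on K" "\<And>i. AE y in M i. dist (z i) y \<le> R"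
        "\<And>i w m. emeasure (M i) (ball w (R * q ^ m)) \<le> ennreal ((1/2) ^ m)"
      by metis
    have split_0: "{..<N} = insert 0 {1..<N}"
      using N by auto
    have "(\<Sum>k=1..<N. ln (sup_norm_on K (chebyshev_poly K k))) \<le> (\<Sum>k=1..<N. \<Sum>j<k. ln (dist (z k) (z j)))"
      by (intro sum_mono sum_ln_distances_lower_bound[OF assms(1,2) leja]) simp
    also have "\<dots> = (\<Sum>k<N. \<Sum>j<k. ln (dist (z k) (z j)))"
      by (simp add: split_0)
    finally have "2 * (\<Sum>k=1..<N. ln (sup_norm_on K (chebyshev_poly K k)))
        \<le> 2 * (\<Sum>k<N. \<Sum>j<k. ln (dist (z k) (z j)))"
      by simp
    also have "\<dots> = (\<Sum>i<N. \<Sum>j\<in>{..<N} - {i}. ln (dist (z i) (z j)))"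
      by (rule sum_off_diagonal_symmetric[symmetric]) (simp add: dist_commute)
    also have "\<dots> \<le> (real N)\<^sup>2 * ln (log_cap K) + real N * (1 + 2 * ln (1 / q) + ln (4 * real N / \<sigma>))"
      using \<sigma>(2)
      by (intro ln_distances_le_capacity[OF assms(1,4) _ diam N zK \<sigma>(1) _ \<sigma>_dist R_def q M])
        (auto simp: D_def)
    also have "ln (4 * real N / \<sigma>) = ln (4 / s) + (1 + a) * ln (real N)"
      using N s(1) by (simp add: \<sigma>_def ln_div ln_mult ln_powr algebra_simps)
    finally show ?thesis
      by (simp add: C_def algebra_simps)
  qed
  then show ?thesis
    using a by (intro exI[of _ "1 + a"] conjI exI[of _ C]) auto
qed

text \<open>
  The squares \<open>N\<^sup>2\<close> cancel against twice the sum of \<open>k\<close> over \<open>k < N\<close> up to the linear term \<open>N\<close>, which leaves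
  an average of order \<open>ln N\<close>; subadditivity passes from the average to the single value.
\<close>

lemma ln_widom_factor_le:
  assumes "compact K" "infinite K" "0 < diameter K" "0 < log_cap K"
    and spread: "carries_spread_measures K q"
  shows "\<exists>c>0. \<exists>C. \<forall>n>0. ln (widom_factor K n) \<le> C + c * ln (real (Suc n))"
proof -
  obtain c C where "0 < c" and avg: "\<And>N. 0 < N \<Longrightarrow>
      2 * (\<Sum>k=1..<N. ln (sup_norm_on K (chebyshev_poly K k)))
    \<le> (real N)\<^sup>2 * ln (log_cap K) + real N * (C + c * ln (real N))"
    using sum_ln_chebyshev_norms_le[OF assms] by blast
  have "K \<noteq> {}" using assms(2) by auto
  define \<tau> where "\<tau> k = sup_norm_on K (chebyshev_poly K k)" for k
  have \<tau>_pos: "0 < \<tau> k" if "0 < k" for k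
    unfolding \<tau>_def using chebyshev_poly_minimal(1)[OF assms(1,2) that] that
    by (intro sup_norm_on_pos assms) auto
  define lc where "lc = ln (log_cap K)"
  \<comment> \<open>The value at \<open>0\<close> is set by hand: minimality is available for positive degrees only.\<close>
  define \<alpha> where "\<alpha> k = (if k = 0 then 0 else ln (\<tau> k) - real k * lc)" for k
  have subadd: "\<alpha> n \<le> \<alpha> k + \<alpha> (n - k)" if "k \<le> n" for n k
  proof (cases "0 < k \<and> k < n")
    case True
    define p where "p = chebyshev_poly K k * chebyshev_poly K (n - k)"
    have kn: "0 < k" "0 < n - k" "0 < n"
      using True by auto
    note T = chebyshev_poly_minimal[OF assms(1,2)]
    have "degree p = n"
      using kn True T(1)[OF kn(1)] T(1)[OF kn(2)] unfolding p_def
      by (subst degree_mult_eq) auto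
    moreover have "lead_coeff p = 1"
      by (simp add: p_def lead_coeff_mult T(2)[OF kn(1)] T(2)[OF kn(2)])
    ultimately have "\<tau> n \<le> sup_norm_on K p"
      unfolding \<tau>_def by (rule T(3)[OF kn(3)])
    also have "\<dots> \<le> \<tau> k * \<tau> (n - k)"
      unfolding p_def \<tau>_def by (rule sup_norm_on_mult_le) fact+
    finally have "ln (\<tau> n) \<le> ln (\<tau> k * \<tau> (n - k))"
      using \<tau>_pos[OF kn(3)] by (intro ln_mono) auto
    also have "\<dots> = ln (\<tau> k) + ln (\<tau> (n - k))"
      using \<tau>_pos[OF kn(1)] \<tau>_pos[OF kn(2)] by (simp add: ln_mult)
    finally show ?thesis
      using True by (simp add: \<alpha>_def of_nat_diff algebra_simps)
  next
    case False
    then have "k = 0 \<or> k = n"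
      using that by auto
    then show ?thesis
      by (auto simp: \<alpha>_def)
  qed
  have "ln (widom_factor K n) \<le> (lc + C) + c * ln (real (Suc n))" if n: "0 < n" for n
  proof -
    define N where "N = Suc n"
    have "{..<N} = insert 0 {1..<N}"
      by (auto simp: N_def)
    then have "(\<Sum>k<N. \<alpha> k) = (\<Sum>k=1..<N. ln (\<tau> k) - real k * lc)"
      by (simp add: \<alpha>_def)
    also have "\<dots> = (\<Sum>k=1..<N. ln (\<tau> k)) - (\<Sum>k=1..<N. real k) * lc"
      by (simp add: sum_subtractf sum_distrib_right)
    also have "(\<Sum>k=1..<N. real k) = real N * (real N - 1) / 2"
    proof -
      have "(\<Sum>k=1..<Suc m. real k) = real (Suc m) * (real (Suc m) - 1) / 2" for m
        by (induction m) (simp_all add: field_simps)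
      then show ?thesis by (simp only: N_def)
    qed
    finally have sum_\<alpha>: "2 * (\<Sum>k<N. \<alpha> k) = 2 * (\<Sum>k=1..<N. ln (\<tau> k)) - real N * (real N - 1) * lc"
      by simp
    have "real N * \<alpha> n \<le> 2 * (\<Sum>k<N. \<alpha> k)"
      unfolding N_def by (rule subadditive_le_twice_average) (rule subadd)
    also have "\<dots> \<le> (real N)\<^sup>2 * lc + real N * (C + c * ln (real N)) - real N * (real N - 1) * lc"
      using avg[of N] unfolding sum_\<alpha> by (simp add: \<tau>_def lc_def N_def)
    also have "\<dots> = real N * (lc + C + c * ln (real N))"
      by (simp add: power2_eq_square algebra_simps)
    finally have "\<alpha> n \<le> lc + C + c * ln (real N)"
      by (rule mult_left_le_imp_le) (simp add: N_def)
    moreover have "\<alpha> n = ln (widom_factor K n)"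
      using n \<tau>_pos[OF n] assms(4)
      by (simp add: \<alpha>_def widom_factor_def \<tau>_def[symmetric] ln_div ln_realpow lc_def)
    ultimately show ?thesis
      by (simp add: N_def)
  qed
  with \<open>0 < c\<close> show ?thesis
    by blast
qed

section \<open>Polynomial growth of Widom factors\<close>

theorem theorem3:
  fixes K :: "complex set"
  assumes "compact K" and "K \<subseteq> \<real>" and "uniformly_perfect K" and "log_cap K > 0"
  shows "\<exists>c>0. (\<lambda>n. widom_factor K n) \<in> O(\<lambda>n. real n powr c)"
proof -
  obtain x y where xy: "x \<in> K" "y \<in> K" "x \<noteq> y"
    using log_cap_pos_imp_two_points[OF assms(1,4)] by blast
  then have diam: "0 < diameter K"
    using diameter_bounded_bound[OF compact_imp_bounded[OF assms(1)] xy(1,2)]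
    by (meson less_le_trans zero_less_dist_iff)
  have inf: "infinite K"
    using uniformly_perfect_infinite[OF assms(3) xy(1) diam] .
  obtain q where "carries_spread_measures K q"
    using uniformly_perfect_carries_spread_measures[OF assms(1,3)] by blast
  from ln_widom_factor_le[OF assms(1) inf diam assms(4) this] obtain c C
    where "0 < c" and bound: "\<And>n. 0 < n \<Longrightarrow> ln (widom_factor K n) \<le> C + c * ln (real (Suc n))"
    by blast
  have "norm (widom_factor K n) \<le> exp C * 2 powr c * norm (real n powr c)" if n: "0 < n" for n
  proof -
    have pos: "0 < widom_factor K n"
      unfolding widom_factor_def
      using chebyshev_poly_minimal(1)[OF assms(1) inf n] n assms(4)
      by (intro divide_pos_pos sup_norm_on_pos assms(1) inf) auto
    then have "widom_factor K n = exp (ln (widom_factor K n))"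
      by simp
    also have "\<dots> \<le> exp (C + c * ln (real (Suc n)))"
      using bound[OF n] by simp
    also have "\<dots> = exp C * real (Suc n) powr c"
      by (simp add: exp_add powr_def)
    \<comment> \<open>\<open>n + 1 \<le> 2 * n\<close> replaces \<open>n + 1\<close> by \<open>n\<close> at the cost of the factor \<open>2 powr c\<close>\<close>
    also have "\<dots> \<le> exp C * (2 * real n) powr c"
      using n \<open>0 < c\<close> by (intro mult_left_mono powr_mono2) auto
    also have "\<dots> = exp C * 2 powr c * real n powr c"
      by (simp add: powr_mult)
    finally show ?thesis
      using pos by simp
  qed
  then have "\<forall>\<^sub>F n in sequentially. norm (widom_factor K n) \<le> exp C * 2 powr c * norm (real n powr c)"
    using eventually_gt_at_top[of 0] by (rule eventually_mono[rotated])
  then have "(\<lambda>n. widom_factor K n) \<in> O(\<lambda>n. real n powr c)"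
    by (rule bigoI)
  with \<open>0 < c\<close> show ?thesis
    by blast
qed

end
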